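(* For every $d\in[1,2]$ there is a continuous function $f:[0,1]\to\mathbb{R}$ such that its graph $\Gamma(f)=\{(x,f(x)):x\in[0,1]\}\subset\mathbb{R}^2$ (with the Euclidean metric) is minimal for conformal dimension and $\dim_C\Gamma(f)=d$.
   Context: $\dim_H$ denotes Hausdorff dimension. A homeomorphism $g:X\to Y$ between metric spaces is quasisymmetric if there is a homeomorphism $\eta:[0,\infty)\to[0,\infty)$ such that $d_Y(g(x),g(y))/d_Y(g(x),g(z))\le\eta\big(d_X(x,y)/d_X(x,z)\big)$ for all $x,y,z\in X$ with $x\neq z$. The conformal dimension is $\dim_C X=\inf\{\dim_H g(X)\}$ over all quasisymmetric homeomorphisms $g$ of $X$ onto metric spaces. $X$ is minimal for conformal dimension if $\dim_C X=\dim_H X$. *)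

theory Defs
  imports "HOL-Analysis.Analysis"
begin

definition mdiam :: "'a metric \<Rightarrow> 'a set \<Rightarrow> ennreal" where
  "mdiam X U = (SUP x\<in>U. SUP y\<in>U. ennreal (mdist X x y))"

(* The s-th power of the diameter, with the usual conventions for s = 0: every nonempty set
   contributes 1 and the empty set contributes 0 (whereas 0 powr 0 = 0 in the library).
   It is only ever applied to sets of finite diameter. *)
definition diam_powr :: "'a metric \<Rightarrow> real \<Rightarrow> 'a set \<Rightarrow> ennreal" where
  "diam_powr X s U =
     (if U = {} then 0 else if s = 0 then 1 else ennreal (enn2real (mdiam X U) powr s))"

definition delta_covers :: "'a metric \<Rightarrow> real \<Rightarrow> 'a set \<Rightarrow> (nat \<Rightarrow> 'a set) set" where
  "delta_covers X \<delta> A =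
     {U. (\<forall>i. U i \<subseteq> mspace X \<and> mdiam X (U i) \<le> ennreal \<delta>) \<and> A \<subseteq> (\<Union>i. U i)}"

(* If A has no countable cover of mesh at most delta, the infimum is over the empty set, i.e. top. *)
definition hausdorff_premeasure :: "'a metric \<Rightarrow> real \<Rightarrow> real \<Rightarrow> 'a set \<Rightarrow> ennreal" where
  "hausdorff_premeasure X s \<delta> A = (INF U\<in>delta_covers X \<delta> A. \<Sum>i. diam_powr X s (U i))"

definition hausdorff_measure :: "'a metric \<Rightarrow> real \<Rightarrow> 'a set \<Rightarrow> ennreal" where
  "hausdorff_measure X s A = (SUP \<delta>\<in>{0<..}. hausdorff_premeasure X s \<delta> A)"

definition hausdorff_dim :: "'a metric \<Rightarrow> ennreal" where
  "hausdorff_dim X = (INF s\<in>{s. 0 \<le> s \<and> hausdorff_measure X s (mspace X) = 0}. ennreal s)"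

definition quasisymmetric_homeo :: "'a metric \<Rightarrow> 'b metric \<Rightarrow> ('a \<Rightarrow> 'b) \<Rightarrow> bool" where
  "quasisymmetric_homeo X Y g \<longleftrightarrow>
     homeomorphic_map (mtopology_of X) (mtopology_of Y) g \<and>
     (\<exists>\<eta> \<eta>' :: real \<Rightarrow> real. homeomorphism {0..} {0..} \<eta> \<eta>' \<and>
       (\<forall>x\<in>mspace X. \<forall>y\<in>mspace X. \<forall>z\<in>mspace X. x \<noteq> z \<longrightarrow>
          mdist Y (g x) (g y) / mdist Y (g x) (g z) \<le> \<eta> (mdist X x y / mdist X x z)))"

(* The infimum ranges over metric spaces whose points are taken from the type of the points of X.
   This loses nothing: the image of a homeomorphism g on X is in bijection with X, so its metric
   can be pulled back along g; see conformal_dim_le below, where Y has an arbitrary type. *)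
definition conformal_dim :: "'a metric \<Rightarrow> ennreal" where
  "conformal_dim X = (INF Y\<in>{Y :: 'a metric. \<exists>g. quasisymmetric_homeo X Y g}. hausdorff_dim Y)"

definition minimal_for_conformal_dim :: "'a metric \<Rightarrow> bool" where
  "minimal_for_conformal_dim X \<longleftrightarrow> conformal_dim X = hausdorff_dim X"

(* The metric of the product type real * real is the Euclidean one (dist_prod_def). *)
definition graph_metric :: "(real \<Rightarrow> real) \<Rightarrow> (real \<times> real) metric" where
  "graph_metric f = submetric euclidean_metric {(x, f x) | x. x \<in> {0..1}}"

lemma hausdorff_dim_isometric_le:
  fixes Z :: "'a metric" and Y :: "'b metric"
  assumes bij: "bij_betw h (mspace Z) (mspace Y)"
    and iso: "\<And>x y. x \<in> mspace Z \<Longrightarrow> y \<in> mspace Z \<Longrightarrow> mdist Z x y = mdist Y (h x) (h y)"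
  shows "hausdorff_dim Z \<le> hausdorff_dim Y"
proof -
  define P where "P V = {x \<in> mspace Z. h x \<in> V}" for V
  have img: "h ` P V = V" if "V \<subseteq> mspace Y" for V
    using that bij unfolding P_def bij_betw_def by auto
  have diam: "mdiam Z (P V) = mdiam Y V" if V: "V \<subseteq> mspace Y" for V
  proof -
    have "mdiam Z (P V) = (SUP x\<in>P V. SUP y\<in>P V. ennreal (mdist Y (h x) (h y)))"
      unfolding mdiam_def by (intro SUP_cong refl) (auto simp: P_def iso)
    also have "\<dots> = (SUP x\<in>h ` P V. SUP y\<in>h ` P V. ennreal (mdist Y x y))"
      by (simp add: image_image)
    finally show ?thesis
      by (simp add: img[OF V] mdiam_def)
  qed
  have powr: "diam_powr Z s (P V) = diam_powr Y s V" if V: "V \<subseteq> mspace Y" for V s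
    using diam[OF V] img[OF V] by (auto simp: diam_powr_def)
  have pre: "hausdorff_premeasure Z s \<delta> (mspace Z) \<le> hausdorff_premeasure Y s \<delta> (mspace Y)" for s \<delta>
    unfolding hausdorff_premeasure_def
  proof (rule INF_mono)
    fix V assume V: "V \<in> delta_covers Y \<delta> (mspace Y)"
    then have sub: "V i \<subseteq> mspace Y" for i
      by (auto simp: delta_covers_def)
    have "mspace Z \<subseteq> (\<Union>i. P (V i))"
      using V bij by (fastforce simp: delta_covers_def P_def bij_betw_def)
    then have "(\<lambda>i. P (V i)) \<in> delta_covers Z \<delta> (mspace Z)"
      using V sub by (auto simp: delta_covers_def diam) (auto simp: P_def)
    moreover have "(\<Sum>i. diam_powr Z s (P (V i))) \<le> (\<Sum>i. diam_powr Y s (V i))"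
      by (simp add: powr[OF sub])
    ultimately show "\<exists>U\<in>delta_covers Z \<delta> (mspace Z).
        (\<Sum>i. diam_powr Z s (U i)) \<le> (\<Sum>i. diam_powr Y s (V i))"
      by (intro bexI[where x = "\<lambda>i. P (V i)"])
  qed
  have "hausdorff_measure Z s (mspace Z) \<le> hausdorff_measure Y s (mspace Y)" for s
    unfolding hausdorff_measure_def by (rule SUP_mono) (use pre in blast)
  then have "hausdorff_measure Z s (mspace Z) = 0" if "hausdorff_measure Y s (mspace Y) = 0" for s
    using that by (metis le_zero_eq)
  then show ?thesis
    unfolding hausdorff_dim_def by (intro INF_superset_mono) auto
qed

lemma conformal_dim_le:
  fixes X :: "'a metric" and Y :: "'b metric"
  assumes qs: "quasisymmetric_homeo X Y g"
  shows "conformal_dim X \<le> hausdorff_dim Y"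
proof -
  define d where "d x y = mdist Y (g x) (g y)" for x y
  define Z where "Z = metric (mspace X, d)"
  have hom: "homeomorphic_map (mtopology_of X) (mtopology_of Y) g"
    using qs by (simp add: quasisymmetric_homeo_def)
  have bij: "bij_betw g (mspace X) (mspace Y)"
    using hom by (metis homeomorphic_eq_everything_map bij_betw_def topspace_mtopology_of)
  then have gin: "g x \<in> mspace Y" if "x \<in> mspace X" for x
    using that by (auto simp: bij_betw_def)
  have inj: "g x = g y \<longleftrightarrow> x = y" if "x \<in> mspace X" "y \<in> mspace X" for x y
    using that bij by (auto simp: bij_betw_def inj_on_def)
  interpret Z: Metric_space "mspace X" d
    by unfold_locales (auto simp: d_def gin inj mdist_commute mdist_triangle)
  have mZ [simp]: "mspace Z = mspace X" "mdist Z = d"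
    by (simp_all add: Z_def)
  interpret ZY: Metric_space12 "mspace Z" "mdist Z" "mspace Y" "mdist Y"
    by (rule Metric_space12_mspace_mdist)
  have homZ: "homeomorphic_map (mtopology_of Z) (mtopology_of Y) g"
    using ZY.isometry_imp_homeomorphic_map[of g] bij
    by (auto simp: mtopology_of_def bij_betw_def d_def)
  then obtain k where k: "homeomorphic_maps (mtopology_of Z) (mtopology_of Y) g k"
    by (auto simp: homeomorphic_map_maps)
  then have "homeomorphic_map (mtopology_of Y) (mtopology_of Z) k"
    using homeomorphic_maps_map by blast
  then have "homeomorphic_map (mtopology_of X) (mtopology_of Z) (k \<circ> g)"
    using hom homeomorphic_map_compose by blast
  moreover have kg: "k (g x) = x" if "x \<in> mspace X" for x
    using k that by (auto simp: homeomorphic_maps_def)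
  ultimately have "quasisymmetric_homeo X Z (k \<circ> g)"
    using qs by (auto simp: quasisymmetric_homeo_def d_def kg)
  then have "conformal_dim X \<le> hausdorff_dim Z"
    unfolding conformal_dim_def by (auto intro: INF_lower)
  also have "\<dots> \<le> hausdorff_dim Y"
    by (rule hausdorff_dim_isometric_le[of g]) (use bij in \<open>auto simp: d_def\<close>)
  finally show ?thesis .
qed

end

theory Submission
  imports Defs
begin

text \<open>
  Put \<open>t = d - 1\<close>. The graph contains a Cantor set of points \<open>(x, y)\<close> that looks like the product of a
  \<open>t\<close>-dimensional Cantor set with \<open>[0, 1]\<close>: the binary digits of \<open>y\<close> are arbitrary, those of \<open>x\<close>
  are arbitrary at a set of positions of density \<open>t\<close>, and at the very sparse positions near \<open>(k + 2)\<^sup>2\<close>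
  the digits of \<open>x\<close> record the \<open>k\<close>-th digit of \<open>y\<close>. So \<open>y\<close> is a continuous function of \<open>x\<close>, but at scale
  \<open>2^-n\<close> the value of \<open>x\<close> only determines about \<open>\<surd>n\<close> digits of \<open>y\<close>, and within a dyadic cell of
  level \<open>n\<close> the next \<open>j\<close> digits of \<open>x\<close> and \<open>y\<close> are independent.

  For a quasisymmetric image, let \<open>D\<close> be the image diameter of a cell. Each of the about \<open>2^(j t)\<close> columns of
  a cell is a chain of \<open>2^j\<close> adjacent subcells joining bottom to top, so \<open>D \<le> c \<Sum> D'\<close> over the column,
  with \<open>c\<close> independent of \<open>j\<close>. The power mean inequality gives \<open>D^s \<le> c^s 2^(j (s - 1 - t)) \<Sum> D'^s\<close> over all
  subcells, and for \<open>s < 1 + t\<close> and large \<open>j\<close> the factor is at most 1. Hence a family of cells with too small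
  \<open>\<Sum> D^s\<close> misses an infinite branch, so the image has positive \<open>s\<close>-dimensional measure
  when \<open>1 \<le> s < 1 + t\<close>. For \<open>t = 0\<close> connectedness of the graph suffices.
\<close>

section \<open>Binary expansions and the encoded curve\<close>

text \<open>Indexing by digit sets turns truncation to \<open>n\<close> digits into intersection
  with \<open>{..<n}\<close>. Dyadic rationals have two digit sets, so cells are indexed by digits
  and not by values.\<close>

definition binval :: "nat set \<Rightarrow> real" where
  "binval B = (\<Sum>p. of_bool (p \<in> B) / 2 ^ Suc p)"

text \<open>The first \<open>n\<close> digits read as an integer. Integrality matters: prefixes that
  differ by less than 1 are equal.\<close>

fun binpre :: "nat set \<Rightarrow> nat \<Rightarrow> int" where
  "binpre B 0 = 0"
| "binpre B (Suc n) = 2 * binpre B n + of_bool (n \<in> B)"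

lemma summable_binval: "summable (\<lambda>p. of_bool (p \<in> B) / 2 ^ Suc p :: real)"
  by (rule summable_comparison_test'[OF summable_divide[OF summable_geometric[of "1/2::real"], of 2]])
     (auto simp: power_one_over field_simps of_bool_def)

lemma binval_nonneg: "0 \<le> binval B"
  unfolding binval_def by (intro suminf_nonneg summable_binval) auto

lemma binval_mono: "B \<subseteq> B' \<Longrightarrow> binval B \<le> binval B'"
  unfolding binval_def by (intro suminf_le summable_binval) (auto simp: divide_right_mono)

lemma binval_UNIV: "binval UNIV = 1"
  using power_half_series unfolding binval_def
  by (simp add: sums_iff power_one_over inverse_eq_divide)

lemma binval_le_1: "binval B \<le> 1"
  using binval_mono[of B UNIV] by (simp add: binval_UNIV)

lemma binval_step: "binval B = (of_bool (0 \<in> B) + binval {p. Suc p \<in> B}) / 2"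
proof -
  have "binval B = of_bool (0 \<in> B) / 2 + (\<Sum>p. of_bool (Suc p \<in> B) / 2 ^ Suc (Suc p))"
    unfolding binval_def using suminf_split_head[OF summable_binval, of B] by simp
  also have "(\<Sum>p. of_bool (Suc p \<in> B) / 2 ^ Suc (Suc p) :: real) =
      (\<Sum>p. of_bool (p \<in> {p. Suc p \<in> B}) / 2 ^ Suc p / 2)"
    by (intro suminf_cong) auto
  also have "\<dots> = binval {p. Suc p \<in> B} / 2"
    unfolding binval_def by (rule suminf_divide[OF summable_binval])
  finally show ?thesis by simp
qed

lemma binval_split: "binval B = (binpre B n + binval {p. p + n \<in> B}) / 2 ^ n"
proof (induction n)
  case (Suc n)
  have "binval {p. p + n \<in> B} = (of_bool (n \<in> B) + binval {p. p + Suc n \<in> B}) / 2"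
    by (subst binval_step) simp
  with Suc show ?case
    by (simp add: field_simps)
qed simp

lemma binpre_bounds:
  "binpre B n \<le> binval B * 2 ^ n" "binval B * 2 ^ n \<le> binpre B n + 1"
  using binval_split[of B n] binval_nonneg[of "{p. p + n \<in> B}"] binval_le_1[of "{p. p + n \<in> B}"]
  by (auto simp: field_simps)

lemma binpre_cong: "B \<inter> {..<n} = B' \<inter> {..<n} \<Longrightarrow> binpre B n = binpre B' n"
proof (induction n)
  case (Suc n)
  then have "B \<inter> {..<n} = B' \<inter> {..<n}" "n \<in> B \<longleftrightarrow> n \<in> B'"
    by (auto simp: set_eq_iff less_Suc_eq)
  with Suc.IH show ?case by simp
qed simp

lemma binpre_eqD: "binpre B n = binpre B' n \<Longrightarrow> B \<inter> {..<n} = B' \<inter> {..<n}"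
proof (induction n)
  case (Suc n)
  have *: "2 * a + of_bool P = 2 * b + of_bool Q \<longleftrightarrow> a = b \<and> P = Q" for a b :: int and P Q
    by (cases P; cases Q; simp; presburger)
  from Suc.prems have "binpre B n = binpre B' n" "(n \<in> B) = (n \<in> B')"
    by (simp_all add: *)
  with Suc.IH show ?case
    by (auto simp: lessThan_Suc)
qed simp

lemma binval_close:
  assumes "B \<inter> {..<n} = B' \<inter> {..<n}"
  shows "\<bar>binval B - binval B'\<bar> \<le> 1 / 2 ^ n"
proof -
  have "\<bar>binval B * 2 ^ n - binval B' * 2 ^ n\<bar> \<le> 1"
    using binpre_bounds[of B n] binpre_bounds[of B' n] binpre_cong[OF assms] by linarith
  then have "\<bar>binval B - binval B'\<bar> * 2 ^ n \<le> 1"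
    by (simp add: abs_mult flip: left_diff_distrib)
  then show ?thesis by (simp add: field_simps)
qed

text \<open>A tail of ones is worth one unit of level \<open>n\<close>: the top of a dyadic interval
  is the bottom of the next one. This is how neighbouring cells of a column meet in height.\<close>

lemma binval_top:
  assumes "R \<subseteq> {..<n}"
  shows "binval (R \<union> {n..}) = binval R + 1 / 2 ^ n"
proof -
  have "{p. p + n \<in> R \<union> {n..}} = UNIV" "{p. p + n \<in> R} = {}"
    using assms by auto
  moreover have "binpre (R \<union> {n..}) n = binpre R n"
    by (rule binpre_cong) auto
  moreover have "binval {} = 0" by (simp add: binval_def)
  ultimately show ?thesis
    using binval_split[of "R \<union> {n..}" n] binval_split[of R n]
    by (simp add: binval_UNIV add_divide_distrib)
qed

lemma binval_insert:
  assumes "n \<notin> R"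
  shows "binval (insert n R) = binval R + 1 / 2 ^ Suc n"
proof -
  have "{p. p + Suc n \<in> insert n R} = {p. p + Suc n \<in> R}" by auto
  moreover have "binpre (insert n R) n = binpre R n"
    by (rule binpre_cong) auto
  ultimately show ?thesis
    using binval_split[of "insert n R" "Suc n"] binval_split[of R "Suc n"] assms
    by (simp add: field_simps)
qed

section \<open>Writing the digits of the ordinate into the abscissa\<close>

text \<open>Squares have growing gaps, so the encoding positions have density zero, and the ordinate
  digits written among the first \<open>enc n\<close> digits of the abscissa are only the first
  \<open>n\<close>.\<close>

definition enc :: "nat \<Rightarrow> nat" where
  "enc k = (k + 2) ^ 2"

definition enc_pos :: "nat set" where
  "enc_pos = range enc \<union> range (\<lambda>k. Suc (enc k))"

lemma enc_gap: "enc k + 2 * k + 5 = enc (Suc k)"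
  by (simp add: enc_def power2_eq_square)

lemma enc_mono: "strict_mono enc"
  unfolding strict_mono_Suc_iff by (simp add: enc_def power2_eq_square)

lemma enc_ge: "k + 4 \<le> enc k"
  by (simp add: enc_def power2_eq_square)

lemma Suc_enc_neq: "Suc (enc k) \<noteq> enc l"
proof
  assume *: "Suc (enc k) = enc l"
  then have "k < l" using enc_mono by (metis lessI strict_mono_less)
  then have "enc (Suc k) \<le> enc l" using enc_mono by (simp add: strict_mono_less_eq)
  with * enc_gap[of k] show False by linarith
qed

text \<open>For \<open>C\<close> disjoint from \<open>enc_pos\<close>, the digits at
  \<open>enc k\<close> and the next position are 10 if \<open>k\<close> is in \<open>R\<close> and
  01 otherwise. The negated copy keeps the tail from \<open>enc k\<close> on away from 0 and
  1.\<close>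

definition join :: "nat set \<Rightarrow> nat set \<Rightarrow> nat set" where
  "join C R = C \<union> enc ` R \<union> (\<lambda>k. Suc (enc k)) ` (- R)"

lemma enc_in_join: "C \<inter> enc_pos = {} \<Longrightarrow> enc k \<in> join C R \<longleftrightarrow> k \<in> R"
  using strict_mono_eq[OF enc_mono] Suc_enc_neq
  by (auto simp: join_def enc_pos_def image_iff) metis

lemma Suc_enc_in_join: "C \<inter> enc_pos = {} \<Longrightarrow> Suc (enc k) \<in> join C R \<longleftrightarrow> k \<notin> R"
  using strict_mono_eq[OF enc_mono] Suc_enc_neq
  by (auto simp: join_def enc_pos_def image_iff)

lemma join_agree:
  assumes "C \<inter> {..<n} = C' \<inter> {..<n}" "R \<inter> {..<n} = R' \<inter> {..<n}"
  shows "join C R \<inter> {..<n} = join C' R' \<inter> {..<n}"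
proof -
  have "k < n" if "enc k < n" for k using that enc_ge[of k] by linarith
  then show ?thesis
    using assms unfolding join_def set_eq_iff by (auto dest: Suc_lessD)
qed

text \<open>Digit \<open>k\<close> of \<open>R\<close> is first written at \<open>enc k\<close>.
  Thus changing \<open>R\<close> from \<open>n\<close> on moves the abscissa by at most
  \<open>1 / 2 ^ enc n\<close>, and the cells of a column lie over almost the same abscissa.\<close>

lemma join_agree_enc:
  assumes "R \<inter> {..<n} = R' \<inter> {..<n}"
  shows "join C R \<inter> {..<enc n} = join C R' \<inter> {..<enc n}"
proof -
  have "k < n" if "enc k < enc n" for k using that enc_mono by (simp add: strict_mono_less)
  then show ?thesis
    using assms unfolding join_def set_eq_iff by (auto dest: Suc_lessD)
qed

text \<open>At an encoding position the two adjacent digits are 01 or 10, so the remaining fraction stays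
  away from 0 and 1 and the digits in front of it are stable under small perturbations.\<close>

lemma join_separation:
  assumes C: "C \<inter> enc_pos = {}" "C' \<inter> enc_pos = {}"
    and close: "\<bar>binval (join C R) - binval (join C' R')\<bar> < 1 / 2 ^ Suc (enc k)"
  shows "join C R \<inter> {..<enc k} = join C' R' \<inter> {..<enc k}"
proof -
  define n where "n = enc k"
  have tail: "1/4 \<le> binval {p. p + n \<in> join C R} \<and> binval {p. p + n \<in> join C R} \<le> 3/4"
    if "C \<inter> enc_pos = {}" for C R
  proof -
    have "binval {p. p + n \<in> join C R} =
        (of_bool (k \<in> R) + (of_bool (k \<notin> R) + binval {p. Suc (Suc p) + n \<in> join C R}) / 2) / 2"
      by (subst binval_step, subst binval_step)
         (simp add: n_def enc_in_join[OF that] Suc_enc_in_join[OF that])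
    then show ?thesis
      using binval_nonneg[of "{p. Suc (Suc p) + n \<in> join C R}"]
        binval_le_1[of "{p. Suc (Suc p) + n \<in> join C R}"] by (cases "k \<in> R") auto
  qed
  let ?a = "binpre (join C R) n" and ?b = "binpre (join C' R') n"
  have "\<bar>binval (join C R) * 2 ^ n - binval (join C' R') * 2 ^ n\<bar> < 1/2"
  proof -
    have "\<bar>binval (join C R) - binval (join C' R')\<bar> * 2 ^ n < 1/2"
      using close by (simp add: n_def field_simps)
    then show ?thesis
      by (simp add: abs_mult flip: left_diff_distrib)
  qed
  moreover have "binval (join C R) * 2 ^ n = ?a + binval {p. p + n \<in> join C R}"
      "binval (join C' R') * 2 ^ n = ?b + binval {p. p + n \<in> join C' R'}"
    using binval_split[of "join C R" n] binval_split[of "join C' R'" n] by (simp_all add: field_simps)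
  \<comment> \<open>Both tails lie in an interval of length 1/2, so the integers differ by less than
    1/2 + 1/2.\<close>
  ultimately have "\<bar>real_of_int ?a - real_of_int ?b\<bar> < 1"
    using tail[OF C(1), of R] tail[OF C(2), of R'] by linarith
  then have "?a = ?b" by linarith
  then show ?thesis using binpre_eqD unfolding n_def by blast
qed

definition curve_point :: "nat set \<Rightarrow> nat set \<Rightarrow> real \<times> real" where
  "curve_point C R = (binval (join C R), binval R)"

lemma dist_le_coords: "dist p q \<le> \<bar>fst p - fst q\<bar> + \<bar>snd p - snd q\<bar>" for p q :: "real \<times> real"
  using sqrt_sum_squares_le_sum_abs[of "dist (fst p) (fst q)" "dist (snd p) (snd q)"]
  by (simp add: dist_prod_def dist_real_def)

lemma coords_le_dist:
  "\<bar>fst p - fst q\<bar> \<le> dist p q" "\<bar>snd p - snd q\<bar> \<le> dist p q" for p q :: "real \<times> real"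
  using dist_fst_le[of p q] dist_snd_le[of p q] by (auto simp: dist_real_def)

lemma dist_curve_point:
  assumes "C \<inter> {..<n} = C' \<inter> {..<n}" "R \<inter> {..<n} = R' \<inter> {..<n}"
  shows "dist (curve_point C R) (curve_point C' R') \<le> 2 / 2 ^ n"
  using dist_le_coords[of "curve_point C R" "curve_point C' R'"]
    binval_close[OF join_agree[OF assms]] binval_close[OF assms(2)]
  by (simp add: curve_point_def)

section \<open>Cells and columns\<close>

text \<open>A set of digit positions with density \<open>t\<close> in every window.\<close>

definition growth_pos :: "real \<Rightarrow> nat set" where
  "growth_pos t = {p. \<lfloor>real p * t\<rfloor> < \<lfloor>real (Suc p) * t\<rfloor>}"

definition free_pos :: "real \<Rightarrow> nat set" where
  "free_pos t = growth_pos t - enc_pos"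

lemma free_pos_disjoint: "free_pos t \<inter> enc_pos = {}"
  by (auto simp: free_pos_def)

text \<open>For \<open>t \<le> 1\<close> the floor of \<open>p * t\<close> grows by 0 or 1 at each
  step, and \<open>growth_pos\<close> collects the steps of growth; the count telescopes.\<close>

lemma card_growth_pos:
  assumes "0 \<le> t" "t \<le> 1"
  shows "int (card (growth_pos t \<inter> {n..<n+j})) = \<lfloor>real (n + j) * t\<rfloor> - \<lfloor>real n * t\<rfloor>"
proof (induction j)
  case (Suc j)
  let ?m = "n + j"
  have le: "real ?m * t \<le> real (Suc ?m) * t" "real (Suc ?m) * t \<le> real ?m * t + 1"
    using assms by (simp_all add: algebra_simps)
  have "\<lfloor>real (Suc ?m) * t\<rfloor> = \<lfloor>real ?m * t\<rfloor> + of_bool (?m \<in> growth_pos t)"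
    using floor_mono[OF le(1)] floor_mono[OF le(2)]
    by (auto simp: growth_pos_def simp del: of_nat_Suc)
  moreover have "growth_pos t \<inter> {n..<n + Suc j} =
      (if ?m \<in> growth_pos t then insert ?m (growth_pos t \<inter> {n..<?m}) else growth_pos t \<inter> {n..<?m})"
    by (auto simp: less_Suc_eq)
  ultimately show ?case
    using Suc by simp
qed simp

lemma card_free_pos_le:
  assumes "0 \<le> t" "t \<le> 1"
  shows "real (card (free_pos t \<inter> {..<n})) \<le> real n * t"
proof -
  have "card (free_pos t \<inter> {..<n}) \<le> card (growth_pos t \<inter> {0..<0+n})"
    by (intro card_mono) (auto simp: free_pos_def)
  then show ?thesis
    using card_growth_pos[OF assms, of 0 n] by simp linarith
qed

text \<open>Two pairs \<open>k < k'\<close> meeting the window would force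
  \<open>2 * k + 5 \<le> j\<close> by \<open>enc_gap\<close>, while
  \<open>j\<^sup>2 < n \<le> enc k + 1\<close> forces \<open>j \<le> k + 2\<close>. So at most one
  pair of encoding positions meets it.\<close>

lemma card_enc_pos_window:
  assumes "j\<^sup>2 < n"
  shows "card (enc_pos \<inter> {n..<n+j}) \<le> 2"
proof -
  have far: "k' \<le> k" if k: "n \<le> Suc (enc k)" "enc k' < n + j" for k k'
  proof (rule ccontr)
    assume "\<not> k' \<le> k"
    then have "enc (Suc k) \<le> enc k'"
      using enc_mono by (simp add: strict_mono_less_eq)
    then have "2 * k + 5 \<le> j"
      using k enc_gap[of k] by linarith
    moreover have "j\<^sup>2 \<le> (k + 2)\<^sup>2"
      using k assms unfolding enc_def by linarith
    then have "j \<le> k + 2"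
      using power2_nat_le_eq_le by blast
    ultimately show False by linarith
  qed
  have enc_of: "\<exists>k. (p = enc k \<or> p = Suc (enc k)) \<and> n \<le> Suc (enc k) \<and> enc k < n + j"
    if "p \<in> enc_pos \<inter> {n..<n+j}" for p
    using that by (force simp: enc_pos_def)
  have "\<exists>k. enc_pos \<inter> {n..<n+j} \<subseteq> {enc k, Suc (enc k)}"
  proof (cases "\<exists>k. n \<le> Suc (enc k) \<and> enc k < n + j")
    case True
    then obtain k where k: "n \<le> Suc (enc k)" "enc k < n + j" by blast
    have "k' = k" if "n \<le> Suc (enc k')" "enc k' < n + j" for k'
      using far[OF k(1) that(2)] far[OF that(1) k(2)] by simp
    then show ?thesis
      using enc_of by blast
  next
    case False
    then show ?thesis
      using enc_of by blast
  qed
  then obtain k where "enc_pos \<inter> {n..<n+j} \<subseteq> {enc k, Suc (enc k)}" by blast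
  then have "card (enc_pos \<inter> {n..<n+j}) \<le> card {enc k, Suc (enc k)}"
    by (intro card_mono) auto
  then show ?thesis by simp
qed

text \<open>Of the loss of 3, the floors account for 1 and the encoding positions in the window for
  2.\<close>

lemma card_free_pos_window:
  assumes "0 \<le> t" "t \<le> 1" "j\<^sup>2 < n"
  shows "real j * t - 3 \<le> real (card (free_pos t \<inter> {n..<n+j}))"
proof -
  have "card (growth_pos t \<inter> {n..<n+j}) \<le> card ((free_pos t \<inter> {n..<n+j}) \<union> (enc_pos \<inter> {n..<n+j}))"
    by (intro card_mono) (auto simp: free_pos_def)
  also have "\<dots> \<le> card (free_pos t \<inter> {n..<n+j}) + card (enc_pos \<inter> {n..<n+j})"
    by (rule card_Un_le)
  finally have "real (card (growth_pos t \<inter> {n..<n+j})) \<le> real (card (free_pos t \<inter> {n..<n+j})) + 2"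
    using card_enc_pos_window[OF assms(3)] by linarith
  moreover have "real (card (growth_pos t \<inter> {n..<n+j})) = of_int (\<lfloor>real (n + j) * t\<rfloor> - \<lfloor>real n * t\<rfloor>)"
    using card_growth_pos[OF assms(1,2), of n j] by (metis of_int_of_nat_eq)
  moreover have "real (n + j) * t = real n * t + real j * t"
    by (simp add: algebra_simps)
  ultimately show ?thesis by linarith
qed

definition cantor_curve :: "real \<Rightarrow> (real \<times> real) set" where
  "cantor_curve t = {curve_point C R |C R. C \<subseteq> free_pos t}"

lemma curve_point_in: "C \<subseteq> free_pos t \<Longrightarrow> curve_point C R \<in> cantor_curve t"
  by (auto simp: cantor_curve_def)

text \<open>The power mean inequality: convexity of \<open>x powr s\<close>, applied with equal
  weights \<open>1 / card V\<close>.\<close>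

lemma sum_powr_le:
  fixes a :: "'b \<Rightarrow> real"
  assumes V: "finite V" "V \<noteq> {}" and pos: "\<And>v. v \<in> V \<Longrightarrow> 0 < a v" and s: "1 \<le> s"
  shows "(\<Sum>v\<in>V. a v) powr s \<le> real (card V) powr (s - 1) * (\<Sum>v\<in>V. a v powr s)"
proof -
  let ?N = "real (card V)"
  have N: "0 < ?N" using V by (simp add: card_gt_0_iff)
  have S: "0 < (\<Sum>v\<in>V. a v)" using V pos by (simp add: sum_pos)
  have "(\<Sum>v\<in>V. (1 / ?N) *\<^sub>R a v) powr s \<le> (\<Sum>v\<in>V. 1 / ?N * a v powr s)"
    by (rule convex_on_sum[OF V powr_convex[OF s]]) (use N pos in auto)
  then have "((\<Sum>v\<in>V. a v) / ?N) powr s \<le> (\<Sum>v\<in>V. a v powr s) / ?N"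
    by (simp flip: sum_divide_distrib)
  then have "(\<Sum>v\<in>V. a v) powr s \<le> ?N powr s * ((\<Sum>v\<in>V. a v powr s) / ?N)"
    using N S by (simp add: powr_divide field_simps)
  also have "\<dots> = ?N powr (s - 1) * (\<Sum>v\<in>V. a v powr s)"
    using N by (simp add: powr_diff)
  finally show ?thesis .
qed

section \<open>Sizes of cells in a quasisymmetric image\<close>

text \<open>\<open>\<delta>\<close> is the image metric pulled back to the curve. Quasisymmetry
  enters through one constant for each ratio bound \<open>T\<close>; continuity makes the images of
  deep cells small.\<close>

locale qs_image = Metric_space "cantor_curve t" \<delta>
  for t :: real and \<delta> :: "real \<times> real \<Rightarrow> real \<times> real \<Rightarrow> real" +
  assumes t_bounds: "0 \<le> t" "t \<le> 1"
    and weak_qs: "\<And>T. \<exists>H. \<forall>p\<in>cantor_curve t. \<forall>q\<in>cantor_curve t. \<forall>r\<in>cantor_curve t.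
          p \<noteq> r \<longrightarrow> dist p q \<le> T * dist p r \<longrightarrow> \<delta> p q \<le> H * \<delta> p r"
    and continuity: "\<And>p \<epsilon>. p \<in> cantor_curve t \<Longrightarrow> 0 < \<epsilon> \<Longrightarrow>
          \<exists>\<tau>>0. \<forall>q\<in>cantor_curve t. dist p q < \<tau> \<longrightarrow> \<delta> p q < \<epsilon>"
begin

abbreviation "F \<equiv> free_pos t"

text \<open>Chosen at least 1, so that multiplying a nonnegative bound by it never decreases the
  bound.\<close>

definition distortion :: "real \<Rightarrow> real" where
  "distortion T = (SOME H. 1 \<le> H \<and> (\<forall>p\<in>cantor_curve t. \<forall>q\<in>cantor_curve t. \<forall>r\<in>cantor_curve t.
          p \<noteq> r \<longrightarrow> dist p q \<le> T * dist p r \<longrightarrow> \<delta> p q \<le> H * \<delta> p r))"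

lemma distortion:
  shows distortion_ge_1: "1 \<le> distortion T"
    and distortion_bound: "\<And>p q r. p \<in> cantor_curve t \<Longrightarrow> q \<in> cantor_curve t \<Longrightarrow>
      r \<in> cantor_curve t \<Longrightarrow> p \<noteq> r \<Longrightarrow> dist p q \<le> T * dist p r \<Longrightarrow> \<delta> p q \<le> distortion T * \<delta> p r"
proof -
  obtain H where H: "\<forall>p\<in>cantor_curve t. \<forall>q\<in>cantor_curve t. \<forall>r\<in>cantor_curve t.
          p \<noteq> r \<longrightarrow> dist p q \<le> T * dist p r \<longrightarrow> \<delta> p q \<le> H * \<delta> p r"
    using weak_qs by blast
  have "\<delta> p q \<le> max 1 H * \<delta> p r" if "\<delta> p q \<le> H * \<delta> p r" for p q r
    using that by (rule order_trans) (auto intro: mult_right_mono)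
  with H have "\<exists>H. 1 \<le> H \<and> (\<forall>p\<in>cantor_curve t. \<forall>q\<in>cantor_curve t. \<forall>r\<in>cantor_curve t.
          p \<noteq> r \<longrightarrow> dist p q \<le> T * dist p r \<longrightarrow> \<delta> p q \<le> H * \<delta> p r)"
    by (intro exI[of _ "max 1 H"]) auto
  from someI_ex[OF this] show "1 \<le> distortion T"
    and "\<And>p q r. p \<in> cantor_curve t \<Longrightarrow> q \<in> cantor_curve t \<Longrightarrow>
      r \<in> cantor_curve t \<Longrightarrow> p \<noteq> r \<Longrightarrow> dist p q \<le> T * dist p r \<Longrightarrow> \<delta> p q \<le> distortion T * \<delta> p r"
    unfolding distortion_def by blast+
qed

lemma top_bottom:
  assumes "R \<subseteq> {..<n}"
  shows "1 / 2 ^ n \<le> dist (curve_point C R) (curve_point C' (R \<union> {n..}))"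
    and "curve_point C R \<noteq> curve_point C' (R \<union> {n..})"
proof -
  show *: "1 / 2 ^ n \<le> dist (curve_point C R) (curve_point C' (R \<union> {n..}))"
    using coords_le_dist(2)[of "curve_point C R" "curve_point C' (R \<union> {n..})"] binval_top[OF assms]
    by (simp add: curve_point_def)
  have "0 < (1::real) / 2 ^ n" by simp
  with * show "curve_point C R \<noteq> curve_point C' (R \<union> {n..})"
    by (metis dist_self not_less)
qed

text \<open>The size, in the target metric, of the cell of all points that share their first \<open>n\<close>
  digits with \<open>(C, R)\<close>; it is measured between a lowest and a highest point of the cell.\<close>

definition spread :: "nat set \<Rightarrow> nat set \<Rightarrow> nat \<Rightarrow> real" where
  "spread C R n = \<delta> (curve_point (C \<inter> {..<n}) (R \<inter> {..<n}))
                    (curve_point (C \<inter> {..<n}) (R \<inter> {..<n} \<union> {n..}))"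

lemma spread_pos:
  assumes "C \<subseteq> F"
  shows "0 < spread C R n"
proof -
  have "curve_point (C \<inter> {..<n}) (R \<inter> {..<n}) \<in> cantor_curve t"
       "curve_point (C \<inter> {..<n}) (R \<inter> {..<n} \<union> {n..}) \<in> cantor_curve t"
    using assms by (auto intro!: curve_point_in)
  then show ?thesis
    unfolding spread_def using top_bottom(2)[of "R \<inter> {..<n}" n "C \<inter> {..<n}" "C \<inter> {..<n}"]
    by (metis mdist_pos_less Int_lower2)
qed

lemma spread_cong:
  "C \<inter> {..<n} = C' \<inter> {..<n} \<Longrightarrow> R \<inter> {..<n} = R' \<inter> {..<n} \<Longrightarrow> spread C R n = spread C' R' n"
  by (simp add: spread_def)

text \<open>Points of a cell lie within \<open>2 / 2 ^ n\<close> of its bottom, while the top is at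
  least \<open>1 / 2 ^ n\<close> away from the bottom; hence the ratio bound 2.\<close>

lemma cell_bottom:
  assumes "C1 \<subseteq> F" "C \<subseteq> F" "R \<subseteq> {..<n}"
    and "C1 \<inter> {..<n} = C \<inter> {..<n}" "R1 \<inter> {..<n} = R"
  shows "\<delta> (curve_point C R) (curve_point C1 R1)
          \<le> distortion 2 * \<delta> (curve_point C R) (curve_point C (R \<union> {n..}))"
proof (rule distortion_bound)
  have "dist (curve_point C R) (curve_point C1 R1) \<le> 2 / 2 ^ n"
    using assms by (intro dist_curve_point) auto
  then show "dist (curve_point C R) (curve_point C1 R1)
      \<le> 2 * dist (curve_point C R) (curve_point C (R \<union> {n..}))"
    using top_bottom(1)[OF assms(3), of C C] by simp
qed (use assms top_bottom(2) in \<open>auto intro!: curve_point_in\<close>)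

text \<open>Two points of the cell are compared through the bottom of the reference column.
  \<open>C\<close> may have digits beyond \<open>n\<close>, so this also compares spreads of one
  cell taken along different columns.\<close>

lemma cell_diameter:
  assumes "C1 \<subseteq> F" "C2 \<subseteq> F" "C \<subseteq> F" "R \<subseteq> {..<n}"
    and "C1 \<inter> {..<n} = C \<inter> {..<n}" "R1 \<inter> {..<n} = R"
    and "C2 \<inter> {..<n} = C \<inter> {..<n}" "R2 \<inter> {..<n} = R"
  shows "\<delta> (curve_point C1 R1) (curve_point C2 R2)
          \<le> 2 * distortion 2 * \<delta> (curve_point C R) (curve_point C (R \<union> {n..}))"
proof -
  have "\<delta> (curve_point C1 R1) (curve_point C2 R2) \<le>
      \<delta> (curve_point C1 R1) (curve_point C R) + \<delta> (curve_point C R) (curve_point C2 R2)"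
    using assms by (intro triangle curve_point_in)
  moreover have "\<delta> (curve_point C1 R1) (curve_point C R) = \<delta> (curve_point C R) (curve_point C1 R1)"
    by (rule commute)
  ultimately show ?thesis
    using cell_bottom[of C1 C R n R1] cell_bottom[of C2 C R n R2] assms by simp
qed

text \<open>Halve the column repeatedly. The upper end \<open>Rz\<close> is given by its value and
  its first \<open>n0\<close> digits, because the top of a half appears both as a tail of ones and
  as a one followed by zeros. The triangle inequality adds the halves without loss, so the factor
  arises once, at level \<open>M\<close>, whatever the number of subcells.\<close>

lemma spread_column:
  assumes C: "C \<subseteq> F" "C \<subseteq> {..<M}" and M: "M \<le> enc n0"
  shows "n \<le> M \<Longrightarrow> n0 \<le> n \<Longrightarrow> R \<subseteq> {..<n} \<Longrightarrow> Rz \<inter> {..<n0} = R \<inter> {..<n0} \<Longrightarrow>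
    binval Rz = binval R + 1 / 2 ^ n \<Longrightarrow>
    \<delta> (curve_point C R) (curve_point C Rz)
      \<le> distortion 2 * (\<Sum>R'\<in>Pow {n..<M}. spread C (R \<union> R') M)"
proof (induction n arbitrary: R Rz rule: inc_induct)
  case base
  have CM: "C \<inter> {..<M} = C" "R \<inter> {..<M} = R" using C base by auto
  \<comment> \<open>The endpoints share \<open>n0\<close> digits of the ordinate, hence
    \<open>enc n0 \<ge> M\<close> digits of the abscissa; both coordinates differ by at most
    \<open>1 / 2 ^ M\<close>.\<close>
  have "\<bar>binval (join C R) - binval (join C Rz)\<bar> \<le> 1 / 2 ^ enc n0"
    by (rule binval_close, rule join_agree_enc) (use base in auto)
  also have "\<dots> \<le> 1 / 2 ^ M"
    using M by (simp add: field_simps)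
  finally have "dist (curve_point C R) (curve_point C Rz) \<le> 2 / 2 ^ M"
    using dist_le_coords[of "curve_point C R" "curve_point C Rz"] base.prems
    by (simp add: curve_point_def)
  then have "dist (curve_point C R) (curve_point C Rz)
      \<le> 2 * dist (curve_point C R) (curve_point C (R \<union> {M..}))"
    using top_bottom(1)[of R M C C] base by simp
  then have "\<delta> (curve_point C R) (curve_point C Rz)
      \<le> distortion 2 * \<delta> (curve_point C R) (curve_point C (R \<union> {M..}))"
    by (intro distortion_bound curve_point_in C top_bottom(2)) (use base in auto)
  then show ?case
    by (simp add: spread_def CM)
next
  case (step n)
  let ?R' = "insert n R"
  have n: "n \<notin> R" using step.prems by auto
  have v: "binval ?R' = binval R + 1 / 2 ^ Suc n" using n by (rule binval_insert)
  have 1: "\<delta> (curve_point C R) (curve_point C ?R')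
      \<le> distortion 2 * (\<Sum>R'\<in>Pow {Suc n..<M}. spread C (R \<union> R') M)"
    by (rule step.IH) (use step.prems v in auto)
  have 2: "\<delta> (curve_point C ?R') (curve_point C Rz)
      \<le> distortion 2 * (\<Sum>R'\<in>Pow {Suc n..<M}. spread C (?R' \<union> R') M)"
    by (rule step.IH) (use step.prems v in auto)
  \<comment> \<open>The subcells of the column split by digit \<open>n\<close>: zero in the lower
    half, one in the upper half.\<close>
  have "{n..<M} = insert n {Suc n..<M}" using step.hyps by auto
  then have "(\<Sum>R'\<in>Pow {n..<M}. spread C (R \<union> R') M) =
      (\<Sum>R'\<in>Pow {Suc n..<M} \<union> insert n ` Pow {Suc n..<M}. spread C (R \<union> R') M)"
    by (simp add: Pow_insert)
  also have "\<dots> = (\<Sum>R'\<in>Pow {Suc n..<M}. spread C (R \<union> R') M) +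
      (\<Sum>R'\<in>insert n ` Pow {Suc n..<M}. spread C (R \<union> R') M)"
    by (rule sum.union_disjoint) auto
  also have "(\<Sum>R'\<in>insert n ` Pow {Suc n..<M}. spread C (R \<union> R') M) =
      (\<Sum>R'\<in>Pow {Suc n..<M}. spread C (R \<union> insert n R') M)"
  proof (rule sum.reindex_cong[OF _ refl refl], rule inj_onI)
    fix A B assume "A \<in> Pow {Suc n..<M}" "B \<in> Pow {Suc n..<M}" and eq: "insert n A = insert n B"
    then have "n \<notin> A" "n \<notin> B" by auto
    with eq show "A = B" by (simp add: insert_ident)
  qed
  finally have eq: "(\<Sum>R'\<in>Pow {n..<M}. spread C (R \<union> R') M) =
      (\<Sum>R'\<in>Pow {Suc n..<M}. spread C (R \<union> R') M) +
      (\<Sum>R'\<in>Pow {Suc n..<M}. spread C (?R' \<union> R') M)"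
    by simp
  have "\<delta> (curve_point C R) (curve_point C Rz) \<le>
      \<delta> (curve_point C R) (curve_point C ?R') + \<delta> (curve_point C ?R') (curve_point C Rz)"
    by (intro triangle curve_point_in C)
  with 1 2 show ?case
    by (simp add: eq distrib_left)
qed

text \<open>The column selected by \<open>C'\<close> carries a chain from bottom to top. The factor
  \<open>2 * distortion 2\<close> pays for moving from the column of \<open>C\<close> to that of
  \<open>C \<union> C'\<close>, a further \<open>distortion 2\<close> for the chain.\<close>

lemma spread_split:
  assumes C: "C \<subseteq> F" "C \<subseteq> {..<n}" and R: "R \<subseteq> {..<n}" and n: "n \<le> M" "M \<le> enc n"
    and C': "C' \<subseteq> F \<inter> {n..<M}"
  shows "spread C R n \<le> 2 * (distortion 2)\<^sup>2 * (\<Sum>R'\<in>Pow {n..<M}. spread (C \<union> C') (R \<union> R') M)"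
proof -
  let ?C = "C \<union> C'" and ?K = "distortion 2"
  have "spread C R n \<le> 2 * ?K * \<delta> (curve_point ?C R) (curve_point ?C (R \<union> {n..}))"
    unfolding spread_def by (rule cell_diameter) (use C R C' in auto)
  also have "\<delta> (curve_point ?C R) (curve_point ?C (R \<union> {n..}))
      \<le> ?K * (\<Sum>R'\<in>Pow {n..<M}. spread ?C (R \<union> R') M)"
    by (rule spread_column[of _ _ n]) (use C R C' n binval_top[OF R] in auto)
  finally show ?thesis
    using distortion_ge_1[of 2] by (simp add: power2_eq_square mult.assoc)
qed

definition children :: "nat \<Rightarrow> nat set \<times> nat set \<Rightarrow> nat \<Rightarrow> (nat set \<times> nat set) set" where
  "children j v n = (\<lambda>(C', R'). (fst v \<union> C', snd v \<union> R')) ` (Pow (F \<inter> {n..<n+j}) \<times> Pow {n..<n+j})"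

text \<open>Each column bounds \<open>spread C R n powr s\<close> by
  \<open>c * 2 powr (J * (s - 1))\<close> times its own sum. Averaging over at least
  \<open>2 powr (J * t - 3)\<close> columns leaves the factor
  \<open>8 * c * 2 powr (- J * (1 + t - s))\<close>, which is at most 1 for large
  \<open>J\<close>.\<close>

lemma spread_powr_le_children:
  assumes s: "1 \<le> s" "s < 1 + t"
  shows "\<exists>j>0. \<forall>n C R. j\<^sup>2 < n \<longrightarrow> C \<subseteq> F \<inter> {..<n} \<longrightarrow> R \<subseteq> {..<n} \<longrightarrow>
    spread C R n powr s \<le> (\<Sum>v\<in>children j (C, R) n. spread (fst v) (snd v) (n + j) powr s)"
proof -
  define c where "c = (2 * (distortion 2)\<^sup>2) powr s"
  have c: "c > 0" using distortion_ge_1[of 2] by (simp add: c_def)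
  \<comment> \<open>The 8 is \<open>2 ^ 3\<close> and makes up for the 3 positions lost in
    \<open>card_free_pos_window\<close>.\<close>
  obtain j :: nat where j: "log 2 (8 * c) / (1 + t - s) < real j"
    using reals_Archimedean2 by blast
  define J where "J = Suc j"
  have J: "J > 0" "log 2 (8 * c) < real J * (1 + t - s)"
    using j s by (auto simp: J_def field_simps)
  then have "2 powr log 2 (8 * c) < 2 powr (real J * (1 + t - s))"
    by (intro powr_less_mono) auto
  then have gain: "8 * c < 2 powr (real J * (1 + t - s))"
    using c by simp
  show ?thesis
  proof (intro exI[of _ J] conjI allI impI J(1))
    fix n C R
    assume n: "J\<^sup>2 < n" and C: "C \<subseteq> F \<inter> {..<n}" and R: "R \<subseteq> {..<n}"
    let ?M = "n + J"
    let ?W = "Pow (F \<inter> {n..<?M})" and ?V = "Pow {n..<?M}"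
    let ?D = "\<lambda>C' R'. spread (C \<union> C') (R \<union> R') ?M"
    \<comment> \<open>New ordinate digits are written only from \<open>enc n\<close> on, beyond the
      window, so they do not disturb the abscissa inside it.\<close>
    have JM: "?M \<le> enc n"
    proof -
      have "J \<le> J\<^sup>2" by (simp add: power2_eq_square)
      then have "?M \<le> 2 * n" using n by linarith
      also have "2 * n \<le> enc n" by (simp add: enc_def power2_eq_square)
      finally show ?thesis .
    qed
    have row: "spread C R n powr s \<le> c * (2 powr (real J * (s - 1)) * (\<Sum>R'\<in>?V. ?D C' R' powr s))"
      if C': "C' \<in> ?W" for C'
    proof -
      have pos: "0 < ?D C' R'" for R' using C C' by (intro spread_pos) auto
      have "spread C R n powr s \<le> (2 * (distortion 2)\<^sup>2 * (\<Sum>R'\<in>?V. ?D C' R')) powr s"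
        by (intro powr_mono2 spread_split JM)
           (use C R C' s spread_pos[of C R n] in \<open>auto intro: less_imp_le\<close>)
      also have "\<dots> = c * (\<Sum>R'\<in>?V. ?D C' R') powr s"
        unfolding c_def by (rule powr_mult)
      also have "(\<Sum>R'\<in>?V. ?D C' R') powr s \<le> real (card ?V) powr (s - 1) * (\<Sum>R'\<in>?V. ?D C' R' powr s)"
        by (rule sum_powr_le) (use pos s in auto)
      also have "real (card ?V) powr (s - 1) = 2 powr (real J * (s - 1))"
        by (simp add: card_Pow powr_powr flip: powr_realpow)
      finally show ?thesis using c by simp
    qed
    have W: "2 powr (real J * t - 3) \<le> real (card ?W)"
    proof -
      have "real J * t - 3 \<le> real (card (F \<inter> {n..<?M}))"
        using card_free_pos_window[OF t_bounds n] .
      then have "2 powr (real J * t - 3) \<le> 2 powr real (card (F \<inter> {n..<?M}))"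
        by (intro powr_mono) auto
      also have "\<dots> = real (card ?W)"
        by (simp add: card_Pow powr_realpow del: Pow_Int_eq)
      finally show ?thesis .
    qed
    let ?S = "\<Sum>C'\<in>?W. \<Sum>R'\<in>?V. ?D C' R' powr s"
    have "2 powr (real J * t - 3) * spread C R n powr s \<le> real (card ?W) * spread C R n powr s"
      using W by (intro mult_right_mono) auto
    also have "\<dots> = (\<Sum>C'\<in>?W. spread C R n powr s)"
      by simp
    also have "\<dots> \<le> (\<Sum>C'\<in>?W. c * (2 powr (real J * (s - 1)) * (\<Sum>R'\<in>?V. ?D C' R' powr s)))"
      by (rule sum_mono) (rule row)
    also have "\<dots> = c * 2 powr (real J * (s - 1)) * ?S"
      by (simp add: sum_distrib_left mult.assoc)
    finally have "2 powr (real J * t - 3) * spread C R n powr s \<le> c * 2 powr (real J * (s - 1)) * ?S" .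
    moreover have "c * 2 powr (real J * (s - 1)) \<le> 2 powr (real J * t - 3)"
    proof -
      have "real J * t - 3 = real J * (1 + t - s) + real J * (s - 1) - 3"
        by (simp add: algebra_simps)
      then have "2 powr (real J * t - 3) = 2 powr (real J * (1 + t - s)) * 2 powr (real J * (s - 1)) / 8"
        by (simp only: powr_add powr_diff) simp
      moreover have "8 * c * 2 powr (real J * (s - 1))
          \<le> 2 powr (real J * (1 + t - s)) * 2 powr (real J * (s - 1))"
        using gain by (intro mult_right_mono) auto
      ultimately show ?thesis by linarith
    qed
    moreover have "0 \<le> ?S" by (intro sum_nonneg) auto
    ultimately have "2 powr (real J * t - 3) * spread C R n powr s \<le> 2 powr (real J * t - 3) * ?S"
      by (meson mult_right_mono order_trans)
    then have "spread C R n powr s \<le> ?S" by simp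
    also have "?S = (\<Sum>v\<in>children J (C, R) n. spread (fst v) (snd v) ?M powr s)"
    proof -
      \<comment> \<open>The new digits are recovered by removing \<open>{..<n}\<close>, so different
        choices give different children.\<close>
      have "inj_on (\<lambda>(C', R'). (C \<union> C', R \<union> R')) (?W \<times> ?V)"
      proof (rule inj_onI, clarify)
        fix C1 R1 C2 R2
        assume "C1 \<subseteq> F \<inter> {n..<?M}" "C2 \<subseteq> F \<inter> {n..<?M}" "R1 \<subseteq> {n..<?M}" "R2 \<subseteq> {n..<?M}"
          and eq: "C \<union> C1 = C \<union> C2" "R \<union> R1 = R \<union> R2"
        then have "C1 = (C \<union> C1) - {..<n}" "C2 = (C \<union> C2) - {..<n}"
            "R1 = (R \<union> R1) - {..<n}" "R2 = (R \<union> R2) - {..<n}"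
          using C R by auto
        with eq show "C1 = C2 \<and> R1 = R2" by metis
      qed
      then show ?thesis
        by (simp add: children_def sum.reindex sum.cartesian_product case_prod_unfold)
    qed
    finally show "spread C R n powr s \<le> (\<Sum>v\<in>children J (C, R) n. spread (fst v) (snd v) ?M powr s)" .
  qed
qed

end

section \<open>Infinite branches and covers by cells\<close>

text \<open>If every child had \<open>w \<le> V\<close>, the two sum conditions would give
  \<open>w i v \<le> V i v\<close>. So a node with \<open>V < w\<close> has a child of the same
  kind, and dependent choice continues forever.\<close>

lemma branch_below_weight:
  fixes w V :: "nat \<Rightarrow> 'n \<Rightarrow> ennreal"
    and node :: "nat \<Rightarrow> 'n \<Rightarrow> bool"
  assumes top_node: "node 0 top_node" "V 0 top_node < w 0 top_node"
    and ch: "\<And>i v c. node i v \<Longrightarrow> c \<in> ch i v \<Longrightarrow> node (Suc i) c"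
    and w: "\<And>i v. node i v \<Longrightarrow> w i v \<le> (\<Sum>c\<in>ch i v. w (Suc i) c)"
    and V: "\<And>i v. node i v \<Longrightarrow> (\<Sum>c\<in>ch i v. V (Suc i) c) \<le> V i v"
  shows "\<exists>b. b 0 = top_node \<and> (\<forall>i. b (Suc i) \<in> ch i (b i) \<and> node i (b i) \<and> V i (b i) < w i (b i))"
proof -
  have "\<exists>b. \<forall>i. (node i (b i) \<and> V i (b i) < w i (b i) \<and> (i = 0 \<longrightarrow> b i = top_node)) \<and> b (Suc i) \<in> ch i (b i)"
  proof (rule dependent_nat_choice)
    show "\<exists>v. node 0 v \<and> V 0 v < w 0 v \<and> (0 = (0::nat) \<longrightarrow> v = top_node)"
      using top_node by auto
  next
    fix v i
    assume v: "node i v \<and> V i v < w i v \<and> (i = 0 \<longrightarrow> v = top_node)"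
    have "\<exists>c\<in>ch i v. V (Suc i) c < w (Suc i) c"
    proof (rule ccontr)
      assume "\<not> (\<exists>c\<in>ch i v. V (Suc i) c < w (Suc i) c)"
      then have "(\<Sum>c\<in>ch i v. w (Suc i) c) \<le> (\<Sum>c\<in>ch i v. V (Suc i) c)"
        by (intro sum_mono) (simp add: not_less)
      with w[of i v] V[of i v] v show False
        by (meson leD order_trans)
    qed
    then show "\<exists>c. (node (Suc i) c \<and> V (Suc i) c < w (Suc i) c \<and> (Suc i = 0 \<longrightarrow> c = top_node)) \<and> c \<in> ch i v"
      using ch v by blast
  qed
  then show ?thesis by blast
qed

lemma finite_image_factor:
  assumes "finite (\<psi> ` U)" and factor: "\<And>u v. u \<in> U \<Longrightarrow> v \<in> U \<Longrightarrow> \<psi> u = \<psi> v \<Longrightarrow> \<phi> u = \<phi> v"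
  shows "finite (\<phi> ` U) \<and> card (\<phi> ` U) \<le> card (\<psi> ` U)"
proof -
  define sel where "sel a = \<phi> (SOME u. u \<in> U \<and> \<psi> u = a)" for a
  have "\<phi> u = sel (\<psi> u)" if "u \<in> U" for u
  proof -
    have "(SOME v. v \<in> U \<and> \<psi> v = \<psi> u) \<in> U \<and> \<psi> (SOME v. v \<in> U \<and> \<psi> v = \<psi> u) = \<psi> u"
      by (rule someI_ex) (use that in blast)
    with factor[OF that] show ?thesis by (simp add: sel_def)
  qed
  then have "\<phi> ` U = sel ` \<psi> ` U" by (auto simp: image_iff)
  with assms(1) show ?thesis by (simp add: card_image_le)
qed

text \<open>Bounds, in terms of \<open>j\<close> only, how many dyadic intervals of level
  \<open>m + j\<close> come within \<open>1 / 2 ^ m\<close> of a point; the extra 1 comes from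
  truncation.\<close>

lemma binpre_close:
  assumes "\<bar>binval B - binval B'\<bar> \<le> 1 / 2 ^ m"
  shows "\<bar>binpre B (m + j) - binpre B' (m + j)\<bar> \<le> 2 ^ j + 1"
proof -
  have "\<bar>binval B * 2 ^ (m + j) - binval B' * 2 ^ (m + j)\<bar> = \<bar>binval B - binval B'\<bar> * 2 ^ (m + j)"
    by (simp add: abs_mult flip: left_diff_distrib)
  also have "\<dots> \<le> 1 / 2 ^ m * 2 ^ (m + j)"
    using assms by (rule mult_right_mono) simp
  finally have "\<bar>binval B * 2 ^ (m + j) - binval B' * 2 ^ (m + j)\<bar> \<le> 2 ^ j"
    by (simp add: power_add)
  then have "\<bar>real_of_int (binpre B (m + j)) - real_of_int (binpre B' (m + j))\<bar> \<le> 2 ^ j + 1"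
    using binpre_bounds[of B "m + j"] binpre_bounds[of B' "m + j"] by linarith
  then have "real_of_int \<bar>binpre B (m + j) - binpre B' (m + j)\<bar> \<le> real_of_int (2 ^ j + 1)"
    by simp
  then show ?thesis by (simp only: of_int_le_iff)
qed

context qs_image
begin

text \<open>The two points that define \<open>spread C R n\<close> lie within
  \<open>2 / 2 ^ n\<close> of \<open>curve_point C R\<close>, so continuity at this point
  suffices.\<close>

lemma spread_tendsto_0:
  assumes "C \<subseteq> F" "0 < \<epsilon>"
  shows "\<exists>n0. \<forall>n\<ge>n0. spread C R n < \<epsilon>"
proof -
  let ?p = "curve_point C R"
  obtain \<tau> where \<tau>: "\<tau> > 0" "\<And>q. q \<in> cantor_curve t \<Longrightarrow> dist ?p q < \<tau> \<Longrightarrow> \<delta> ?p q < \<epsilon> / 2"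
    using continuity[of ?p "\<epsilon> / 2"] assms curve_point_in by auto
  obtain n0 where n0: "(1/2) ^ n0 < \<tau> / 2"
    using real_arch_pow_inv[of "\<tau> / 2" "1/2"] \<tau> by auto
  have "spread C R n < \<epsilon>" if "n \<ge> n0" for n
  proof -
    have "(1/2) ^ n \<le> ((1/2) ^ n0 :: real)" using that by (intro power_decreasing) auto
    then have n: "2 / 2 ^ n < \<tau>" using n0 by (simp add: power_one_over)
    let ?a = "curve_point (C \<inter> {..<n}) (R \<inter> {..<n})"
    let ?b = "curve_point (C \<inter> {..<n}) (R \<inter> {..<n} \<union> {n..})"
    have "dist ?p ?a \<le> 2 / 2 ^ n" "dist ?p ?b \<le> 2 / 2 ^ n"
      by (intro dist_curve_point; auto)+
    moreover have in_c: "?a \<in> cantor_curve t" "?b \<in> cantor_curve t" "?p \<in> cantor_curve t"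
      using assms by (auto intro!: curve_point_in)
    ultimately have "\<delta> ?p ?a < \<epsilon> / 2" "\<delta> ?p ?b < \<epsilon> / 2"
      using \<tau>(2)[of ?a] \<tau>(2)[of ?b] n by linarith+
    moreover have "\<delta> ?a ?b \<le> \<delta> ?a ?p + \<delta> ?p ?b"
      using in_c by (intro triangle)
    ultimately show ?thesis
      by (simp add: spread_def commute)
  qed
  then show ?thesis by blast
qed

definition cell :: "nat \<Rightarrow> nat set \<times> nat set \<Rightarrow> nat set \<times> nat set" where
  "cell n u = (fst u \<inter> {..<n}, snd u \<inter> {..<n})"

text \<open>Bottom and top are at least \<open>1 / 2 ^ n\<close> apart, so one of them is at least
  half of that away from the given point. It serves as the comparison point \<open>r\<close> in
  \<open>distortion_bound\<close>.\<close>

lemma far_endpoint: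
  assumes "C \<subseteq> F"
  obtains q where "q \<in> cantor_curve t" "1 / (2 * 2 ^ n) \<le> dist (curve_point C R) q"
    "\<delta> (curve_point C R) q \<le> 2 * distortion 2 * spread C R n"
proof -
  let ?p = "curve_point C R"
  let ?a = "curve_point (C \<inter> {..<n}) (R \<inter> {..<n})"
  let ?b = "curve_point (C \<inter> {..<n}) (R \<inter> {..<n} \<union> {n..})"
  have "1 / 2 ^ n \<le> dist ?a ?b"
    by (rule top_bottom) auto
  also have "\<dots> \<le> dist ?p ?a + dist ?p ?b"
    by (metis dist_commute dist_triangle)
  finally have "1 / (2 * 2 ^ n) \<le> dist ?p ?a \<or> 1 / (2 * 2 ^ n) \<le> dist ?p ?b"
    by (auto simp: field_simps)
  moreover have "\<delta> ?p ?a \<le> 2 * distortion 2 * spread C R n" "\<delta> ?p ?b \<le> 2 * distortion 2 * spread C R n"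
    unfolding spread_def by (intro cell_diameter; use assms in auto)+
  moreover have "?a \<in> cantor_curve t" "?b \<in> cantor_curve t"
    using assms by (auto intro!: curve_point_in)
  ultimately show ?thesis using that by blast
qed

text \<open>The stage at which the first cell of a point of \<open>U\<close> becomes smaller than a fixed multiple of the
  diameter of \<open>U\<close> works for all points of \<open>U\<close> at once: by quasisymmetry \<open>U\<close> lies within distance
  \<open>1 / 2 ^ m\<close> in the curve, where \<open>m\<close> is the preceding level.\<close>

lemma cover_by_cells:
  fixes j m0 :: nat
  assumes s: "0 \<le> s"
  defines "m \<equiv> \<lambda>i. m0 + i * j"
  shows "\<exists>K>0. \<forall>U \<rho>. U \<noteq> {} \<longrightarrow> (\<forall>u\<in>U. fst u \<subseteq> F \<and> cell m0 u = ({}, {})) \<longrightarrow>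
    0 < \<rho> \<longrightarrow> (\<forall>u\<in>U. \<forall>v\<in>U. \<delta> (curve_point (fst u) (snd u)) (curve_point (fst v) (snd v)) \<le> \<rho>) \<longrightarrow>
    3 * distortion 2 * \<rho> \<le> spread {} {} m0 \<longrightarrow> 0 < j \<longrightarrow>
    (\<exists>i. finite (cell (m i) ` U) \<and>
       (\<Sum>v\<in>cell (m i) ` U. spread (fst v) (snd v) (m i) powr s) \<le> K * \<rho> powr s)"
proof -
  define k :: int where "k = 2 ^ j + 1"
  \<comment> \<open>With \<open>L\<close> the level before \<open>m i\<close>, this is the ratio of
    \<open>1 / 2 ^ L + 2 / 2 ^ (L + j)\<close> to \<open>1 / (2 * 2 ^ (L + j))\<close>, the
    distances compared in \<open>size\<close>.\<close>
  define T where "T = 2 * (2 ^ j + 2 :: real)"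
  define K1 where "K1 = 12 * distortion T * (distortion 2)\<^sup>2"
  have K1: "K1 > 0" using distortion_ge_1[of T] distortion_ge_1[of 2] by (auto simp: K1_def)
  \<comment> \<open>The number of integer pairs within \<open>k\<close> of a given pair in each
    coordinate.\<close>
  define N where "N = nat (2 * k + 1) * nat (2 * k + 1)"
  show ?thesis
  proof (intro exI[of _ "real N * K1 powr s"] conjI allI impI)
    show "0 < real N * K1 powr s" using K1 by (auto simp: N_def k_def intro!: mult_pos_pos add_pos_pos)
  next
    fix U :: "(nat set \<times> nat set) set" and \<rho> :: real
    assume ne: "U \<noteq> {}" and U: "\<forall>u\<in>U. fst u \<subseteq> F \<and> cell m0 u = ({}, {})" and \<rho>: "0 < \<rho>"
      and diam: "\<forall>u\<in>U. \<forall>v\<in>U. \<delta> (curve_point (fst u) (snd u)) (curve_point (fst v) (snd v)) \<le> \<rho>"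
      and big: "3 * distortion 2 * \<rho> \<le> spread {} {} m0" and j: "0 < j"
    let ?p = "\<lambda>u. curve_point (fst u) (snd u)"
    \<comment> \<open>The 3 leaves room: a cell whose two endpoints have images within
      \<open>distortion 2 * \<rho>\<close> of one point has spread at most
      \<open>2 * distortion 2 * \<rho>\<close>, hence is small.\<close>
    define small where "small u i \<longleftrightarrow> spread (fst u) (snd u) (m i) < 3 * distortion 2 * \<rho>" for u i
    have "\<exists>i. small u i" if "u \<in> U" for u
    proof -
      have uF': "fst u \<subseteq> F" using U that by blast
      have pos: "0 < 3 * distortion 2 * \<rho>" using \<rho> distortion_ge_1[of 2] by simp
      obtain n0 where n0: "\<And>n. n \<ge> n0 \<Longrightarrow> spread (fst u) (snd u) n < 3 * distortion 2 * \<rho>"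
        using spread_tendsto_0[OF uF' pos] by blast
      have "n0 \<le> m n0" using j by (simp add: m_def trans_le_add2)
      with n0 show ?thesis unfolding small_def by blast
    qed
    with ne have ex: "\<exists>i. \<exists>u\<in>U. small u i" by blast
    define i where "i = (LEAST i. \<exists>u\<in>U. small u i)"
    from LeastI_ex[OF ex] obtain u where u: "u \<in> U" "small u i"
      unfolding i_def by blast
    have "\<not> small u 0"
    proof -
      have "spread (fst u) (snd u) m0 = spread {} {} m0"
        by (rule spread_cong) (use U u in \<open>auto simp: cell_def\<close>)
      with big show ?thesis by (simp add: small_def m_def)
    qed
    with u obtain i' where i': "i = Suc i'" by (cases i) auto
    have not_small: "\<not> small u i'"
      using not_less_Least[of i' "\<lambda>i. \<exists>u\<in>U. small u i"] u i' by (auto simp flip: i_def)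
    define L where "L = m i'"
    have mi: "m i = L + j" by (simp add: m_def L_def i')
    have uF: "fst u \<subseteq> F" using U u by blast
    have pin: "?p v \<in> cantor_curve t" if "v \<in> U" for v
      using U that by (intro curve_point_in) auto
    \<comment> \<open>If \<open>v\<close> were farther, both endpoints of the level \<open>L\<close>
      cell of \<open>u\<close> would lie within twice its distance from \<open>u\<close>, and that
      cell would be small, against the choice of \<open>i\<close>.\<close>
    have near: "dist (?p u) (?p v) \<le> 1 / 2 ^ L" if v: "v \<in> U" for v
    proof (rule ccontr)
      assume far: "\<not> dist (?p u) (?p v) \<le> 1 / 2 ^ L"
      then have ne: "?p u \<noteq> ?p v" by auto
      let ?a = "curve_point (fst u \<inter> {..<L}) (snd u \<inter> {..<L})"
      let ?b = "curve_point (fst u \<inter> {..<L}) (snd u \<inter> {..<L} \<union> {L..})"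
      have ab: "?a \<in> cantor_curve t" "?b \<in> cantor_curve t"
        using uF by (auto intro!: curve_point_in)
      have *: "\<delta> (?p u) q \<le> distortion 2 * \<rho>" if "q \<in> cantor_curve t" "dist (?p u) q \<le> 2 / 2 ^ L" for q
      proof -
        have "dist (?p u) q \<le> 2 * dist (?p u) (?p v)"
          using that(2) far by simp
        then have "\<delta> (?p u) q \<le> distortion 2 * \<delta> (?p u) (?p v)"
          by (rule distortion_bound[OF pin[OF u(1)] that(1) pin[OF v] ne])
        also have "\<dots> \<le> distortion 2 * \<rho>"
          using diam u v distortion_ge_1[of 2] by (intro mult_left_mono) auto
        finally show ?thesis .
      qed
      have "\<delta> (?p u) ?a \<le> distortion 2 * \<rho>" "\<delta> (?p u) ?b \<le> distortion 2 * \<rho>"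
        by (intro * ab dist_curve_point; auto)+
      moreover have "\<delta> ?a ?b \<le> \<delta> ?a (?p u) + \<delta> (?p u) ?b"
        using ab pin[OF u(1)] by (intro triangle)
      ultimately have "spread (fst u) (snd u) L \<le> 2 * (distortion 2 * \<rho>)"
        by (simp add: spread_def commute)
      moreover have "0 < distortion 2 * \<rho>" using \<rho> distortion_ge_1[of 2] by simp
      ultimately show False using not_small by (simp add: small_def L_def)
    qed
    \<comment> \<open>The image distance from \<open>u\<close> to \<open>q\<close> is controlled by
      the small cell of \<open>u\<close>, and the level \<open>m i\<close> cell of \<open>v\<close>
      lies within \<open>T\<close> times the distance from \<open>u\<close> to
      \<open>q\<close>.\<close>
    have size: "spread (fst v) (snd v) (m i) \<le> K1 * \<rho>" if v: "v \<in> U" for v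
    proof -
      let ?M = "m i"
      obtain q where q: "q \<in> cantor_curve t" "1 / (2 * 2 ^ ?M) \<le> dist (?p u) q"
          "\<delta> (?p u) q \<le> 2 * distortion 2 * spread (fst u) (snd u) ?M"
        using far_endpoint[OF uF] by blast
      have ne: "?p u \<noteq> q"
      proof
        assume "?p u = q"
        moreover have "0 < 1 / (2 * 2 ^ ?M :: real)" by simp
        ultimately show False using q(2) by (metis dist_self not_less)
      qed
      have qb: "\<delta> (?p u) q \<le> 2 * distortion 2 * (3 * distortion 2 * \<rho>)"
        using q(3) u(2) distortion_ge_1[of 2] unfolding small_def
        by (meson less_imp_le mult_left_mono order_trans mult_nonneg_nonneg zero_le_numeral zero_le_one)
      let ?a = "curve_point (fst v \<inter> {..<?M}) (snd v \<inter> {..<?M})"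
      let ?b = "curve_point (fst v \<inter> {..<?M}) (snd v \<inter> {..<?M} \<union> {?M..})"
      have ab: "?a \<in> cantor_curve t" "?b \<in> cantor_curve t"
        using U v by (auto intro!: curve_point_in)
      have *: "\<delta> (?p u) c \<le> distortion T * \<delta> (?p u) q"
        if c: "c \<in> cantor_curve t" "dist (?p v) c \<le> 2 / 2 ^ ?M" for c
      proof (rule distortion_bound[OF pin[OF u(1)] c(1) q(1) ne])
        have "dist (?p u) c \<le> 1 / 2 ^ L + 2 / 2 ^ ?M"
          using near[OF v] c(2) dist_triangle[of "?p u" c "?p v"] by linarith
        also have "\<dots> = T * (1 / (2 * 2 ^ ?M))"
          by (simp add: mi T_def power_add field_simps)
        also have "\<dots> \<le> T * dist (?p u) q"
          using q(2) by (intro mult_left_mono) (auto simp: T_def)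
        finally show "dist (?p u) c \<le> T * dist (?p u) q" .
      qed
      have "\<delta> (?p u) ?a \<le> distortion T * \<delta> (?p u) q" "\<delta> (?p u) ?b \<le> distortion T * \<delta> (?p u) q"
        by (intro * ab dist_curve_point; auto)+
      moreover have "\<delta> ?a ?b \<le> \<delta> ?a (?p u) + \<delta> (?p u) ?b"
        using ab pin[OF u(1)] by (intro triangle)
      ultimately have "spread (fst v) (snd v) ?M \<le> 2 * (distortion T * \<delta> (?p u) q)"
        by (simp add: spread_def commute)
      also have "\<dots> \<le> 2 * (distortion T * (2 * distortion 2 * (3 * distortion 2 * \<rho>)))"
        using qb distortion_ge_1[of T] by (intro mult_left_mono) auto
      also have "\<dots> = K1 * \<rho>"
        by (simp add: K1_def power2_eq_square)
      finally show ?thesis .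
    qed
    \<comment> \<open>The integer prefixes of both coordinates determine the cell: intersecting the
      digits of the abscissa with \<open>F\<close> gives back the free digits.\<close>
    define \<psi> where "\<psi> v = (binpre (join (fst v) (snd v)) (m i), binpre (snd v) (m i))"
      for v :: "nat set \<times> nat set"
    let ?box = "{fst (\<psi> u) - k..fst (\<psi> u) + k} \<times> {snd (\<psi> u) - k..snd (\<psi> u) + k}"
    have "\<psi> ` U \<subseteq> ?box"
    proof (rule image_subsetI)
      fix v assume v: "v \<in> U"
      have 1: "\<bar>binval (join (fst u) (snd u)) - binval (join (fst v) (snd v))\<bar> \<le> 1 / 2 ^ L"
        and 2: "\<bar>binval (snd u) - binval (snd v)\<bar> \<le> 1 / 2 ^ L"
        using near[OF v] coords_le_dist[of "?p u" "?p v"] by (auto simp: curve_point_def)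
      show "\<psi> v \<in> ?box"
        using binpre_close[OF 1, of j] binpre_close[OF 2, of j]
        by (auto simp: \<psi>_def mi k_def)
    qed
    moreover have "finite ?box" "card ?box = N"
      by (simp_all add: card_cartesian_product N_def k_def)
    ultimately have \<psi>: "finite (\<psi> ` U)" "card (\<psi> ` U) \<le> N"
      by (auto intro: finite_subset dest: card_mono[rotated])
    have factor: "cell (m i) v = cell (m i) v'"
      if v: "v \<in> U" "v' \<in> U" and eq: "\<psi> v = \<psi> v'" for v v'
    proof -
      have "join (fst v) (snd v) \<inter> {..<m i} = join (fst v') (snd v') \<inter> {..<m i}"
        using eq by (auto simp: \<psi>_def dest!: binpre_eqD)
      moreover have "fst w \<inter> {..<m i} = join (fst w) (snd w) \<inter> {..<m i} \<inter> F" if "w \<in> U" for w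
      proof -
        have "fst w \<subseteq> F" using U that by blast
        then show ?thesis by (auto simp: join_def free_pos_def enc_pos_def)
      qed
      ultimately have "fst v \<inter> {..<m i} = fst v' \<inter> {..<m i}" using v by metis
      moreover have "snd v \<inter> {..<m i} = snd v' \<inter> {..<m i}"
        using eq by (auto simp: \<psi>_def dest!: binpre_eqD)
      ultimately show ?thesis by (simp add: cell_def)
    qed
    have "finite (cell (m i) ` U) \<and> card (cell (m i) ` U) \<le> card (\<psi> ` U)"
      by (rule finite_image_factor[OF \<psi>(1)]) (rule factor)
    then have fin: "finite (cell (m i) ` U)" "card (cell (m i) ` U) \<le> N"
      using \<psi>(2) by simp_all
    have "spread (fst v) (snd v) (m i) powr s \<le> (K1 * \<rho>) powr s" if v: "v \<in> cell (m i) ` U" for v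
    proof -
      obtain w where w: "w \<in> U" "v = cell (m i) w" using v by blast
      have "spread (fst v) (snd v) (m i) = spread (fst w) (snd w) (m i)"
        by (rule spread_cong) (auto simp: w cell_def)
      moreover have "0 < spread (fst w) (snd w) (m i)"
        using U w by (intro spread_pos) auto
      ultimately show ?thesis using size[OF w(1)] s by (intro powr_mono2) auto
    qed
    then have "(\<Sum>v\<in>cell (m i) ` U. spread (fst v) (snd v) (m i) powr s)
        \<le> real (card (cell (m i) ` U)) * (K1 * \<rho>) powr s"
      by (rule sum_bounded_above)
    also have "\<dots> \<le> real N * (K1 * \<rho>) powr s"
      using fin by (intro mult_right_mono) auto
    also have "\<dots> = real N * K1 powr s * \<rho> powr s"
      by (simp add: powr_mult)
    finally show "\<exists>i. finite (cell (m i) ` U) \<and>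
        (\<Sum>v\<in>cell (m i) ` U. spread (fst v) (snd v) (m i) powr s) \<le> real N * K1 powr s * \<rho> powr s"
      using fin by blast
  qed
qed

text \<open>Each set of a cover is exchanged for finitely many cells with comparable
  \<open>s\<close>-sum. If the total were below the weight of the root, some branch would at each
  node outweigh the chosen cells below that node. Its limit point is covered, so one of its nodes is
  itself a chosen cell, a contradiction.\<close>

lemma no_small_cover:
  assumes s: "1 \<le> s" "s < 1 + t"
  shows "\<exists>\<epsilon>::real>0. \<forall>U \<rho>. (\<forall>l. 0 < \<rho> l) \<longrightarrow>
    (\<forall>l. \<forall>u\<in>U l. \<forall>v\<in>U l. \<delta> (curve_point (fst u) (snd u)) (curve_point (fst v) (snd v)) \<le> \<rho> l) \<longrightarrow>
    (\<forall>C R. C \<subseteq> F \<longrightarrow> (\<exists>l::nat. (C, R) \<in> U l)) \<longrightarrow> ennreal \<epsilon> \<le> (\<Sum>l. ennreal (\<rho> l powr s))"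
proof -
  obtain j where j: "j > 0" and grow: "\<And>n C R. j\<^sup>2 < n \<Longrightarrow> C \<subseteq> F \<inter> {..<n} \<Longrightarrow> R \<subseteq> {..<n} \<Longrightarrow>
    spread C R n powr s \<le> (\<Sum>v\<in>children j (C, R) n. spread (fst v) (snd v) (n + j) powr s)"
    using spread_powr_le_children[OF s] by blast
  \<comment> \<open>All levels must exceed \<open>j\<^sup>2\<close> for \<open>grow\<close> to
    apply.\<close>
  define m0 where "m0 = Suc (j\<^sup>2)"
  define m where "m i = m0 + i * j" for i
  have m0: "m 0 = m0" by (simp add: m_def)
  have mSuc: "m (Suc i) = m i + j" for i by (simp add: m_def)
  have m_mono: "i \<le> i' \<Longrightarrow> m i \<le> m i'" for i i' by (simp add: m_def)
  define D0 where "D0 = spread {} {} m0"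
  have D0: "D0 > 0" by (simp add: D0_def spread_pos)
  let ?p = "\<lambda>u. curve_point (fst u) (snd u)"
  obtain K where K: "K > 0" and cover: "\<And>U \<rho>. U \<noteq> {} \<Longrightarrow> \<forall>u\<in>U. fst u \<subseteq> F \<and> cell m0 u = ({}, {}) \<Longrightarrow>
      0 < \<rho> \<Longrightarrow> \<forall>u\<in>U. \<forall>v\<in>U. \<delta> (?p u) (?p v) \<le> \<rho> \<Longrightarrow> 3 * distortion 2 * \<rho> \<le> D0 \<Longrightarrow>
      \<exists>i. finite (cell (m i) ` U) \<and>
       (\<Sum>v\<in>cell (m i) ` U. spread (fst v) (snd v) (m i) powr s) \<le> K * \<rho> powr s"
    using cover_by_cells[of s m0 j] s j unfolding m_def D0_def by fastforce
  \<comment> \<open>The first bound forces every \<open>\<rho> l\<close> into the range where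
    \<open>cover\<close> applies; the second keeps the total below the root weight
    \<open>D0 powr s\<close>.\<close>
  define e where "e = min ((D0 / (3 * distortion 2)) powr s) (D0 powr s / K)"
  have e: "e > 0" using D0 K distortion_ge_1[of 2] by (simp add: e_def)
  show ?thesis
  proof (intro exI[of _ e] conjI allI impI)
    show "0 < e" by (rule e)
  next
    fix U :: "nat \<Rightarrow> (nat set \<times> nat set) set" and \<rho> :: "nat \<Rightarrow> real"
    assume \<rho>: "\<forall>l. 0 < \<rho> l" and diam: "\<forall>l. \<forall>u\<in>U l. \<forall>v\<in>U l. \<delta> (?p u) (?p v) \<le> \<rho> l"
      and cov: "\<forall>C R. C \<subseteq> F \<longrightarrow> (\<exists>l. (C, R) \<in> U l)"
    show "ennreal e \<le> (\<Sum>l. ennreal (\<rho> l powr s))"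
    proof (rule ccontr)
      assume "\<not> ennreal e \<le> (\<Sum>l. ennreal (\<rho> l powr s))"
      then have less: "(\<Sum>l. ennreal (\<rho> l powr s)) < ennreal e" by simp
      have small: "3 * distortion 2 * \<rho> l \<le> D0" for l
      proof -
        have "(\<Sum>i\<in>{l}. ennreal (\<rho> i powr s)) \<le> (\<Sum>l. ennreal (\<rho> l powr s))"
          by (rule sum_le_suminf) auto
        then have "ennreal (\<rho> l powr s) < ennreal e" using less by simp
        then have "\<rho> l powr s < (D0 / (3 * distortion 2)) powr s"
          by (simp add: ennreal_less_iff e_def)
        moreover have "(D0 / (3 * distortion 2)) powr s \<le> \<rho> l powr s" if "D0 / (3 * distortion 2) \<le> \<rho> l"
          using that s D0 distortion_ge_1[of 2] by (intro powr_mono2) auto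
        ultimately have "\<rho> l < D0 / (3 * distortion 2)"
          by (meson not_less)
        then show ?thesis
          using distortion_ge_1[of 2] by (simp add: field_simps)
      qed
      \<comment> \<open>Only parameters in the root cell, with no digits below \<open>m0\<close>,
        are followed.\<close>
      define U' where "U' l = {u \<in> U l. fst u \<subseteq> F \<and> cell m0 u = ({}, {})}" for l
      have "\<exists>i. finite (cell (m i) ` U' l) \<and>
          (\<Sum>v\<in>cell (m i) ` U' l. spread (fst v) (snd v) (m i) powr s) \<le> K * \<rho> l powr s" for l
      proof (cases "U' l = {}")
        case True
        then show ?thesis using K by simp
      next
        case False
        then show ?thesis
          by (intro cover) (use \<rho> diam small in \<open>auto simp: U'_def\<close>)
      qed
      then have "\<exists>I. \<forall>l. finite (cell (m (I l)) ` U' l) \<and>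
          (\<Sum>v\<in>cell (m (I l)) ` U' l. spread (fst v) (snd v) (m (I l)) powr s) \<le> K * \<rho> l powr s"
        by (intro choice allI)
      then obtain I where fin: "\<And>l. finite (cell (m (I l)) ` U' l)" and sum_le: "\<And>l.
          (\<Sum>v\<in>cell (m (I l)) ` U' l. spread (fst v) (snd v) (m (I l)) powr s) \<le> K * \<rho> l powr s"
        by auto
      define W where "W z = ennreal (spread (fst (snd z)) (snd (snd z)) (m (fst z)) powr s)"
        for z :: "nat \<times> nat set \<times> nat set"
      \<comment> \<open>Point masses on pairs of a level and a cell. The measure counts a cell
        chosen for several \<open>l\<close> only once, and gives subadditivity over \<open>l\<close>
        and additivity over disjoint subtrees.\<close>
      define \<zeta> where "\<zeta> = density (count_space UNIV) W"
      have sets_\<zeta>: "A \<in> sets \<zeta>" for A by (simp add: \<zeta>_def)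
      have \<zeta>_fin: "emeasure \<zeta> A = (\<Sum>z\<in>A. W z)" if "finite A" for A
        using that unfolding \<zeta>_def
        by (subst emeasure_density) (auto simp flip: nn_integral_count_space_indicator
            simp: nn_integral_count_space_finite)
      define Z where "Z l = {I l} \<times> cell (m (I l)) ` U' l" for l
      define below where "below i v = {z. i \<le> fst z \<and> cell (m i) (snd z) = v}"
        for i and v :: "nat set \<times> nat set"
      define V where "V i v = emeasure \<zeta> ((\<Union>l. Z l) \<inter> below i v)" for i v
      define nd where "nd i v \<longleftrightarrow> fst v \<subseteq> F \<inter> {..<m i} \<and> snd v \<subseteq> {..<m i}"
        for i and v :: "nat set \<times> nat set"
      have cell_cell: "cell n (cell n' v) = cell n v" if "n \<le> n'" for n n' v
        using that by (auto simp: cell_def)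
      have ch_cell: "cell (m i) c = v" if "nd i v" "c \<in> children j v (m i)" for i v c
        using that by (auto simp: nd_def children_def cell_def prod_eq_iff)
      have "\<exists>b. b 0 = ({}, {}) \<and>
        (\<forall>i. b (Suc i) \<in> children j (b i) (m i) \<and> nd i (b i) \<and> V i (b i) < W (i, b i))"
      proof (rule branch_below_weight)
        show "nd 0 ({}, {})" by (simp add: nd_def)
      next
        have "V 0 ({}, {}) \<le> emeasure \<zeta> (\<Union>l. Z l)"
          unfolding V_def by (rule emeasure_mono) (auto simp: sets_\<zeta>)
        also have "\<dots> \<le> (\<Sum>l. emeasure \<zeta> (Z l))"
          by (rule emeasure_subadditive_countably) (auto simp: sets_\<zeta>)
        also have "\<dots> \<le> (\<Sum>l. ennreal K * ennreal (\<rho> l powr s))"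
        proof (intro suminf_le)
          fix l
          have "emeasure \<zeta> (Z l) = (\<Sum>z\<in>Z l. W z)"
            by (rule \<zeta>_fin) (simp add: Z_def fin)
          also have "\<dots> = (\<Sum>v\<in>cell (m (I l)) ` U' l. W (I l, v))"
            unfolding Z_def by (rule sum.reindex_bij_witness[of _ "\<lambda>v. (I l, v)" snd]) auto
          also have "\<dots> = ennreal (\<Sum>v\<in>cell (m (I l)) ` U' l. spread (fst v) (snd v) (m (I l)) powr s)"
            by (simp add: W_def)
          also have "\<dots> \<le> ennreal (K * \<rho> l powr s)"
            by (rule ennreal_leI) (rule sum_le)
          also have "\<dots> = ennreal K * ennreal (\<rho> l powr s)"
            using K by (simp add: ennreal_mult)
          finally show "emeasure \<zeta> (Z l) \<le> ennreal K * ennreal (\<rho> l powr s)" .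
        qed auto
        also have "\<dots> = ennreal K * (\<Sum>l. ennreal (\<rho> l powr s))"
          by simp
        also have "\<dots> < ennreal K * ennreal e"
          using less K by (intro ennreal_mult_strict_left_mono) auto
        also have "\<dots> = ennreal (K * e)"
          using K e by (simp add: ennreal_mult)
        also have "\<dots> \<le> ennreal (D0 powr s)"
        proof (rule ennreal_leI)
          have "K * e \<le> K * (D0 powr s / K)" using K by (intro mult_left_mono) (auto simp: e_def)
          then show "K * e \<le> D0 powr s" using K by simp
        qed
        finally show "V 0 ({}, {}) < W (0, ({}, {}))"
          by (simp add: W_def D0_def m0)
      next
        fix i v c assume "nd i v" "c \<in> children j v (m i)"
        then show "nd (Suc i) c"
          by (auto simp: nd_def children_def mSuc) force+
      next
        fix i v assume v: "nd i v"
        have "j\<^sup>2 < m i" by (simp add: m_def m0_def)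
        then have "spread (fst v) (snd v) (m i) powr s
            \<le> (\<Sum>c\<in>children j v (m i). spread (fst c) (snd c) (m (Suc i)) powr s)"
          using grow[of "m i" "fst v" "snd v"] v by (simp add: nd_def mSuc)
        then show "W (i, v) \<le> (\<Sum>c\<in>children j v (m i). W (Suc i, c))"
          by (simp add: W_def ennreal_leI)
      next
        fix i v assume v: "nd i v"
        have "finite (children j v (m i))" by (simp add: children_def)
        then have "(\<Sum>c\<in>children j v (m i). V (Suc i) c) =
            emeasure \<zeta> (\<Union>c\<in>children j v (m i). (\<Union>l. Z l) \<inter> below (Suc i) c)"
          unfolding V_def
          by (intro sum_emeasure) (auto simp: sets_\<zeta> disjoint_family_on_def below_def)
        also have "\<dots> \<le> V i v"
          unfolding V_def
        proof (rule emeasure_mono)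
          have "below (Suc i) c \<subseteq> below i v" if "c \<in> children j v (m i)" for c
            using ch_cell[OF v that] cell_cell[OF m_mono[of i "Suc i"]] by (auto simp: below_def)
          then show "(\<Union>c\<in>children j v (m i). (\<Union>l. Z l) \<inter> below (Suc i) c) \<subseteq> (\<Union>l. Z l) \<inter> below i v"
            by blast
        qed (simp add: sets_\<zeta>)
        finally show "(\<Sum>c\<in>children j v (m i). V (Suc i) c) \<le> V i v" .
      qed
      then obtain b where b0: "b 0 = ({}, {})" and b: "\<And>i. b (Suc i) \<in> children j (b i) (m i)"
          "\<And>i. nd i (b i)" "\<And>i. V i (b i) < W (i, b i)" by blast
      have down: "cell (m i) (b i') = b i" if "i \<le> i'" for i i'
        using that
      proof (induction i' rule: dec_induct)
        case base
        then show ?case using b(2)[of i] by (auto simp: cell_def nd_def prod_eq_iff)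
      next
        case (step k)
        have "cell (m k) (b (Suc k)) = b k" by (rule ch_cell[OF b(2,1)])
        then show ?case using step cell_cell[OF m_mono[of i k], of "b (Suc k)"] by simp
      qed
      \<comment> \<open>The branch has a limit parameter whose truncations are exactly its
        nodes.\<close>
      define C where "C = (\<Union>i. fst (b i))"
      define R where "R = (\<Union>i. snd (b i))"
      have limit: "cell (m i) (C, R) = b i" for i
      proof -
        have "fst (b i') \<inter> {..<m i} \<subseteq> fst (b i) \<and> snd (b i') \<inter> {..<m i} \<subseteq> snd (b i)" for i'
        proof (cases "i \<le> i'")
          case True
          then have "cell (m i) (b i') = b i" by (rule down)
          then show ?thesis unfolding cell_def by (metis fst_conv snd_conv order_refl)
        next
          case False
          then have "cell (m i') (b i) = b i'" by (intro down) simp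
          then show ?thesis unfolding cell_def by (metis fst_conv snd_conv Int_lower1 le_infI1)
        qed
        moreover have "fst (b i) \<subseteq> {..<m i}" "snd (b i) \<subseteq> {..<m i}"
          using b(2)[of i] by (auto simp: nd_def)
        ultimately show ?thesis
          unfolding cell_def C_def R_def by (fastforce simp: prod_eq_iff)
      qed
      have "C \<subseteq> F" using b(2) by (force simp: C_def nd_def)
      then obtain l where "(C, R) \<in> U l" using cov by blast
      then have l: "(C, R) \<in> U' l"
        using limit[of 0] \<open>C \<subseteq> F\<close> by (simp add: U'_def m0 b0)
      let ?i = "I l"
      \<comment> \<open>The cell chosen at level \<open>I l\<close> for the set containing the limit
        is a node of the branch, so \<open>V\<close> there is at least the weight of that
        node.\<close>
      have "(?i, b ?i) \<in> (\<Union>l. Z l) \<inter> below ?i (b ?i)"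
        using l limit[of ?i] down[of ?i ?i] by (force simp: Z_def below_def)
      then have "emeasure \<zeta> {(?i, b ?i)} \<le> V ?i (b ?i)"
        unfolding V_def by (intro emeasure_mono) (auto simp: sets_\<zeta>)
      then show False
        using b(3)[of ?i] by (simp add: \<zeta>_fin)
    qed
  qed
qed

end

section \<open>Hausdorff measure\<close>

lemma mdiam_le:
  assumes "\<And>x y. x \<in> U \<Longrightarrow> y \<in> U \<Longrightarrow> mdist X x y \<le> \<rho>"
  shows "mdiam X U \<le> ennreal \<rho>"
  unfolding mdiam_def by (intro SUP_least ennreal_leI assms)

lemma diam_powr_le:
  assumes "\<And>x y. x \<in> U \<Longrightarrow> y \<in> U \<Longrightarrow> mdist X x y \<le> \<rho>" and "0 < s" "0 \<le> \<rho>"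
  shows "diam_powr X s U \<le> ennreal (\<rho> powr s)"
proof -
  have "enn2real (mdiam X U) \<le> \<rho>"
    using mdiam_le[OF assms(1)] assms(3) by (intro enn2real_leI) auto
  then have "enn2real (mdiam X U) powr s \<le> \<rho> powr s"
    using assms by (intro powr_mono2) auto
  then show ?thesis
    using assms by (auto simp: diam_powr_def ennreal_leI)
qed

text \<open>The piece \<open>B k\<close> gets the share \<open>\<epsilon> / 2 ^ (k + 1)\<close> of
  the sum. The mesh is controlled by the sum as well: a nonempty family with
  \<open>card * \<rho> powr s < \<delta> powr s\<close> has
  \<open>\<rho> \<le> \<delta>\<close>.\<close>

lemma hausdorff_measure_eq_0I:
  fixes B :: "nat \<Rightarrow> 'a set"
  assumes s: "0 < s" and cov: "mspace X \<subseteq> (\<Union>k. B k)"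
    and fin: "\<And>k \<epsilon>. 0 < \<epsilon> \<Longrightarrow> \<exists>\<V> \<rho>. finite \<V> \<and> 0 \<le> \<rho> \<and>
      (\<forall>V\<in>\<V>. V \<subseteq> mspace X \<and> (\<forall>x\<in>V. \<forall>y\<in>V. mdist X x y \<le> \<rho>)) \<and>
      B k \<subseteq> \<Union>\<V> \<and> real (card \<V>) * \<rho> powr s < \<epsilon>"
  shows "hausdorff_measure X s (mspace X) = 0"
proof -
  have small: "hausdorff_premeasure X s \<delta> (mspace X) \<le> 0 + ennreal \<epsilon>" if \<delta>: "\<delta> > 0" and \<epsilon>: "0 < \<epsilon>" for \<delta> \<epsilon>
  proof -
    define e where "e k = min (\<epsilon> * (1/2) ^ Suc k) (\<delta> powr s)" for k
    have e: "e k > 0" for k using \<epsilon> \<delta> by (simp add: e_def)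
    have "\<forall>k. \<exists>\<V> \<rho>. finite \<V> \<and> 0 \<le> \<rho> \<and>
      (\<forall>V\<in>\<V>. V \<subseteq> mspace X \<and> (\<forall>x\<in>V. \<forall>y\<in>V. mdist X x y \<le> \<rho>)) \<and>
      B k \<subseteq> \<Union>\<V> \<and> real (card \<V>) * \<rho> powr s < e k"
      using fin[OF e] by blast
    from this[THEN choice] obtain \<V> where "\<forall>k. \<exists>\<rho>. finite (\<V> k) \<and> 0 \<le> \<rho> \<and>
      (\<forall>V\<in>\<V> k. V \<subseteq> mspace X \<and> (\<forall>x\<in>V. \<forall>y\<in>V. mdist X x y \<le> \<rho>)) \<and>
      B k \<subseteq> \<Union>(\<V> k) \<and> real (card (\<V> k)) * \<rho> powr s < e k" ..
    from this[THEN choice] obtain \<rho> where *: "\<forall>k. finite (\<V> k) \<and> 0 \<le> \<rho> k \<and>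
      (\<forall>V\<in>\<V> k. V \<subseteq> mspace X \<and> (\<forall>x\<in>V. \<forall>y\<in>V. mdist X x y \<le> \<rho> k)) \<and>
      B k \<subseteq> \<Union>(\<V> k) \<and> real (card (\<V> k)) * \<rho> k powr s < e k" ..
    then have VR: "\<And>k. finite (\<V> k)" "\<And>k. 0 \<le> \<rho> k" "\<And>k V. V \<in> \<V> k \<Longrightarrow> V \<subseteq> mspace X"
      "\<And>k V x y. V \<in> \<V> k \<Longrightarrow> x \<in> V \<Longrightarrow> y \<in> V \<Longrightarrow> mdist X x y \<le> \<rho> k"
      "\<And>k. B k \<subseteq> \<Union>(\<V> k)" "\<And>k. real (card (\<V> k)) * \<rho> k powr s < e k"
      by blast+
    have "\<forall>k. \<exists>h. bij_betw h {0..<card (\<V> k)} (\<V> k)"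
      using VR(1) ex_bij_betw_nat_finite by blast
    from this[THEN choice] obtain h where h: "\<And>k. bij_betw (h k) {0..<card (\<V> k)} (\<V> k)" by blast
    have h_in: "h k i \<in> \<V> k" if "i < card (\<V> k)" for k i
      using h[of k] that by (auto simp: bij_betw_def)
    \<comment> \<open>Each finite family is padded with empty sets, which contribute 0, so that
      \<open>prod_decode\<close> enumerates all families in one sequence.\<close>
    define W where "W p = (if snd p < card (\<V> (fst p)) then h (fst p) (snd p) else {})" for p
    have W_dist: "mdist X x y \<le> \<rho> (fst p)" if "x \<in> W p" "y \<in> W p" for p x y
      using that VR(4)[OF h_in[of "snd p" "fst p"]] by (auto simp: W_def split: if_splits)
    have \<rho>_le: "\<rho> k \<le> \<delta>" if "card (\<V> k) > 0" for k
    proof (rule ccontr)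
      assume "\<not> \<rho> k \<le> \<delta>"
      then have "\<delta> powr s \<le> \<rho> k powr s" using s \<delta> by (intro powr_mono2) auto
      also have "\<dots> \<le> real (card (\<V> k)) * \<rho> k powr s"
        using that by (simp add: mult_le_cancel_right1)
      also have "\<dots> < \<delta> powr s" using VR(6)[of k] by (simp add: e_def)
      finally show False by simp
    qed
    have "mdiam X (W p) \<le> ennreal \<delta>" for p
    proof (rule mdiam_le)
      fix x y assume "x \<in> W p" "y \<in> W p"
      then show "mdist X x y \<le> \<delta>"
        using W_dist[of x p y] \<rho>_le[of "fst p"] by (auto simp: W_def split: if_splits)
    qed
    moreover have "W p \<subseteq> mspace X" for p
      using VR(3)[OF h_in[of "snd p" "fst p"]] by (auto simp: W_def)
    moreover have "mspace X \<subseteq> (\<Union>n. W (prod_decode n))"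
    proof
      fix x assume "x \<in> mspace X"
      then obtain k where "x \<in> B k" using cov by blast
      then obtain V where "V \<in> \<V> k" "x \<in> V" using VR(5)[of k] by blast
      then obtain i where "i < card (\<V> k)" "x \<in> h k i"
        using h[of k] by (auto simp: bij_betw_def image_iff) (metis atLeast0LessThan imageE lessThan_iff)
      then have "x \<in> W (prod_decode (prod_encode (k, i)))" by (simp add: W_def)
      then show "x \<in> (\<Union>n. W (prod_decode n))" by blast
    qed
    ultimately have "(\<lambda>n. W (prod_decode n)) \<in> delta_covers X \<delta> (mspace X)"
      by (simp add: delta_covers_def)
    then have "hausdorff_premeasure X s \<delta> (mspace X) \<le> (\<Sum>n. diam_powr X s (W (prod_decode n)))"
      unfolding hausdorff_premeasure_def by (rule INF_lower)
    also have "\<dots> = (\<Sum>k. \<Sum>i. diam_powr X s (W (k, i)))"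
      by (rule suminf_ennreal_2dimen) simp
    also have "\<dots> \<le> (\<Sum>k. ennreal (\<epsilon> * (1/2) ^ Suc k))"
    proof (intro suminf_le)
      fix k
      have "(\<Sum>i. diam_powr X s (W (k, i))) = (\<Sum>i<card (\<V> k). diam_powr X s (W (k, i)))"
        by (rule suminf_finite) (auto simp: W_def diam_powr_def)
      also have "\<dots> \<le> (\<Sum>i<card (\<V> k). ennreal (\<rho> k powr s))"
        using W_dist[of _ "(k, _)"] by (intro sum_mono diam_powr_le) (use s VR(2) in auto)
      also have "\<dots> = ennreal (real (card (\<V> k)) * \<rho> k powr s)"
        by (simp add: ennreal_mult ennreal_of_nat_eq_real_of_nat)
      also have "\<dots> \<le> ennreal (\<epsilon> * (1/2) ^ Suc k)"
        using VR(6)[of k] by (intro ennreal_leI) (simp add: e_def)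
      finally show "(\<Sum>i. diam_powr X s (W (k, i))) \<le> ennreal (\<epsilon> * (1/2) ^ Suc k)" .
    qed auto
    also have "\<dots> = ennreal \<epsilon>"
      using sums_mult[OF power_half_series, of \<epsilon>] \<epsilon>
      by (intro suminf_ennreal_eq) auto
    finally show ?thesis by simp
  qed
  have "hausdorff_premeasure X s \<delta> (mspace X) \<le> 0" if "\<delta> > 0" for \<delta>
    by (rule ennreal_le_epsilon) (rule small[OF that])
  then show ?thesis
    by (auto simp: hausdorff_measure_def)
qed

text \<open>Brings null covers into the form used for lower bounds: exponent
  \<open>s \<ge> 1\<close> and strictly positive size bounds. For mesh at most 1, raising the
  exponent from \<open>r\<close> to \<open>s\<close> does not increase the sum.\<close>

lemma hausdorff_measure_0_cover:
  assumes H: "hausdorff_measure X r (mspace X) = 0" and r: "0 \<le> r" "r \<le> s" "1 \<le> s" and \<epsilon>: "0 < \<epsilon>"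
  shows "\<exists>U \<rho>. (\<forall>l::nat. 0 < \<rho> l \<and> U l \<subseteq> mspace X \<and> (\<forall>x\<in>U l. \<forall>y\<in>U l. mdist X x y \<le> \<rho> l)) \<and>
    mspace X \<subseteq> (\<Union>l. U l) \<and> (\<Sum>l. ennreal (\<rho> l powr s)) < ennreal \<epsilon>"
proof -
  have "hausdorff_premeasure X r 1 (mspace X) \<le> hausdorff_measure X r (mspace X)"
    unfolding hausdorff_measure_def by (rule SUP_upper) simp
  then have "hausdorff_premeasure X r 1 (mspace X) < ennreal (\<epsilon> / 2)"
    using H \<epsilon> by simp
  then obtain U where U: "U \<in> delta_covers X 1 (mspace X)" "(\<Sum>i. diam_powr X r (U i)) < ennreal (\<epsilon> / 2)"
    unfolding hausdorff_premeasure_def INF_less_iff by blast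
  have Ui: "U i \<subseteq> mspace X" "mdiam X (U i) \<le> 1" for i
    using U(1) by (auto simp: delta_covers_def)
  define a where "a i = enn2real (mdiam X (U i))" for i
  have a: "0 \<le> a i" "a i \<le> 1" for i
    using Ui(2)[of i] by (auto simp: a_def intro!: enn2real_leI)
  have dist_a: "mdist X x y \<le> a i" if "x \<in> U i" "y \<in> U i" for x y i
  proof -
    have "ennreal (mdist X x y) \<le> (SUP y\<in>U i. ennreal (mdist X x y))"
      using that by (intro SUP_upper)
    also have "\<dots> \<le> mdiam X (U i)"
      unfolding mdiam_def using that by (intro SUP_upper)
    also have "\<dots> = ennreal (a i)"
      using Ui(2)[of i] by (simp add: a_def) (metis ennreal_enn2real ennreal_one_less_top leD le_less_trans top.not_eq_extremum)
    finally show ?thesis using a by simp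
  qed
  have a_powr: "ennreal (a i powr s) \<le> diam_powr X r (U i)" for i
  proof (cases "U i = {}")
    case True
    then show ?thesis using r by (simp add: a_def mdiam_def bot_ennreal)
  next
    case False
    have "a i powr s \<le> (if r = 0 then 1 else a i powr r)"
    proof (cases "r = 0")
      case True
      then show ?thesis using a r by (simp add: powr_le1)
    next
      case False
      then show ?thesis using a r powr_mono'[of r s "a i"] by simp
    qed
    with False show ?thesis
      by (auto simp: diam_powr_def a_def intro!: ennreal_leI split: if_splits)
  qed
  \<comment> \<open>Positive slack with sum \<open>\<epsilon> / 2\<close>, so that sets of diameter
    0 also get a positive \<open>\<rho>\<close>.\<close>
  define \<eta> where "\<eta> i = \<epsilon> / 2 * (1/2) ^ Suc i" for i :: nat
  have \<eta>: "\<eta> i > 0" for i using \<epsilon> by (simp add: \<eta>_def)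
  define \<rho> where "\<rho> i = (a i powr s + \<eta> i) powr (1 / s)" for i
  have \<rho>_powr: "\<rho> i powr s = a i powr s + \<eta> i" for i
    using \<eta>[of i] r by (simp add: \<rho>_def powr_powr add_nonneg_nonneg less_imp_le)
  have "a i \<le> \<rho> i" for i
  proof -
    have "a i = (a i powr s) powr (1 / s)" using a r by (simp add: powr_powr)
    also have "\<dots> \<le> \<rho> i" unfolding \<rho>_def using \<eta>[of i] r by (intro powr_mono2) auto
    finally show ?thesis .
  qed
  moreover have "0 < \<rho> i" for i
    unfolding \<rho>_def using \<eta>[of i] by (metis add_nonneg_pos powr_ge_zero powr_gt_zero less_irrefl)
  moreover have "(\<Sum>i. ennreal (\<rho> i powr s)) < ennreal \<epsilon>"
  proof -
    have "(\<Sum>i. ennreal (\<rho> i powr s)) = (\<Sum>i. ennreal (a i powr s) + ennreal (\<eta> i))"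
      using \<eta> by (simp add: \<rho>_powr ennreal_plus less_imp_le)
    also have "\<dots> = (\<Sum>i. ennreal (a i powr s)) + (\<Sum>i. ennreal (\<eta> i))"
      by (rule suminf_add[symmetric]) auto
    also have "(\<Sum>i. ennreal (\<eta> i)) = ennreal (\<epsilon> / 2)"
      unfolding \<eta>_def using sums_mult[OF power_half_series, of "\<epsilon> / 2"] \<epsilon>
      by (intro suminf_ennreal_eq) auto
    also have "(\<Sum>i. ennreal (a i powr s)) + ennreal (\<epsilon> / 2) \<le> (\<Sum>i. diam_powr X r (U i)) + ennreal (\<epsilon> / 2)"
      by (intro add_right_mono suminf_le a_powr) auto
    also have "\<dots> < ennreal (\<epsilon> / 2) + ennreal (\<epsilon> / 2)"
      using U(2) by (simp add: ennreal_add_left_cancel_less add.commute)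
    also have "\<dots> = ennreal \<epsilon>"
      using \<epsilon> by (simp flip: ennreal_plus)
    finally show ?thesis .
  qed
  moreover have "mspace X \<subseteq> (\<Union>i. U i)" using U(1) by (simp add: delta_covers_def)
  ultimately show ?thesis
    using Ui(1) dist_a by (intro exI[of _ U] exI[of _ \<rho>]) (meson order_trans)
qed

lemma hausdorff_dim_leI:
  assumes "0 \<le> d" "\<And>s. d < s \<Longrightarrow> hausdorff_measure X s (mspace X) = 0"
  shows "hausdorff_dim X \<le> ennreal d"
proof (rule ennreal_le_epsilon)
  fix e :: real assume "0 < e"
  then have "hausdorff_dim X \<le> ennreal (d + e)"
    unfolding hausdorff_dim_def using assms by (intro INF_lower) auto
  then show "hausdorff_dim X \<le> ennreal d + ennreal e"
    using \<open>0 < e\<close> assms(1) by (simp add: ennreal_plus)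
qed

lemma hausdorff_dim_geI:
  assumes "\<And>s. 0 \<le> s \<Longrightarrow> s < d \<Longrightarrow> hausdorff_measure X s (mspace X) \<noteq> 0"
  shows "ennreal d \<le> hausdorff_dim X"
  unfolding hausdorff_dim_def
proof (rule INF_greatest)
  fix s assume "s \<in> {s. 0 \<le> s \<and> hausdorff_measure X s (mspace X) = 0}"
  with assms[of s] show "ennreal d \<le> ennreal s" by (intro ennreal_leI) force
qed

text \<open>The distance to \<open>a\<close> is 1-Lipschitz and by connectedness takes all values in
  \<open>{0..L}\<close>. A cover with sum of sizes below \<open>L / 2\<close> would cover this
  interval by intervals of total length below \<open>L\<close>.\<close>

lemma hausdorff_dim_connected:
  assumes conn: "connected_space (mtopology_of X)" and ab: "a \<in> mspace X" "b \<in> mspace X" "a \<noteq> b"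
  shows "1 \<le> hausdorff_dim X"
proof -
  have "hausdorff_measure X s (mspace X) \<noteq> 0" if s: "0 \<le> s" "s < 1" for s
  proof
    assume H: "hausdorff_measure X s (mspace X) = 0"
    interpret X: Metric_space "mspace X" "mdist X" by (rule Metric_space_mspace_mdist)
    define L where "L = mdist X a b"
    have L: "L > 0" using ab by (simp add: L_def)
    have "\<exists>U \<rho>. (\<forall>l::nat. 0 < \<rho> l \<and> U l \<subseteq> mspace X \<and> (\<forall>x\<in>U l. \<forall>y\<in>U l. mdist X x y \<le> \<rho> l)) \<and>
        mspace X \<subseteq> (\<Union>l. U l) \<and> (\<Sum>l. ennreal (\<rho> l powr 1)) < ennreal (L / 2)"
      by (rule hausdorff_measure_0_cover[OF H]) (use s L in auto)
    then obtain U \<rho> where *: "(\<forall>l::nat. 0 < \<rho> l \<and> U l \<subseteq> mspace X \<and> (\<forall>x\<in>U l. \<forall>y\<in>U l. mdist X x y \<le> \<rho> l)) \<and>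
        mspace X \<subseteq> (\<Union>l. U l) \<and> (\<Sum>l. ennreal (\<rho> l powr 1)) < ennreal (L / 2)"
      by (elim exE)
    then have U: "\<And>l::nat. 0 < \<rho> l" "\<And>l. U l \<subseteq> mspace X"
        "\<And>l x y. x \<in> U l \<Longrightarrow> y \<in> U l \<Longrightarrow> mdist X x y \<le> \<rho> l"
        "mspace X \<subseteq> (\<Union>l. U l)" "(\<Sum>l. ennreal (\<rho> l powr 1)) < ennreal (L / 2)"
      by blast+
    let ?\<phi> = "mdist X a"
    have "continuous_map (mtopology_of X) euclidean ?\<phi>"
      using ab by (intro continuous_map_mdist) auto
    then have "connectedin euclidean (?\<phi> ` mspace X)"
      using conn by (metis connectedin_continuous_map_image connectedin_topspace topspace_mtopology_of)
    then have "connected (?\<phi> ` mspace X)" by simp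
    moreover have "0 \<in> ?\<phi> ` mspace X" "L \<in> ?\<phi> ` mspace X"
      using ab by (auto simp: L_def intro: image_eqI[of _ _ a])
    ultimately have sub: "{0..L} \<subseteq> ?\<phi> ` mspace X"
      by (rule connected_contains_Icc)
    define c where "c l = ?\<phi> (SOME x. x \<in> U l)" for l
    have "{0..L} \<subseteq> (\<Union>l. {c l - \<rho> l..c l + \<rho> l})"
    proof
      fix y assume "y \<in> {0..L}"
      then obtain x where x: "x \<in> mspace X" "y = ?\<phi> x" using sub by blast
      then obtain l where l: "x \<in> U l" using U(4) by blast
      define z where "z = (SOME x. x \<in> U l)"
      have z: "z \<in> U l" unfolding z_def using l by (rule someI)
      have "mdist X x z \<le> \<rho> l" using U(3) l z by blast
      moreover have "?\<phi> x \<le> ?\<phi> z + mdist X z x" "?\<phi> z \<le> ?\<phi> x + mdist X x z"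
        using U(2)[of l] z x(1) ab(1) by (auto intro!: X.triangle)
      ultimately have "\<bar>?\<phi> x - c l\<bar> \<le> \<rho> l"
        using X.commute[of x z] by (simp add: c_def flip: z_def)
      then show "y \<in> (\<Union>l. {c l - \<rho> l..c l + \<rho> l})" using x by (intro UN_I[of l]) auto
    qed
    then have "emeasure lborel {0..L} \<le> emeasure lborel (\<Union>l. {c l - \<rho> l..c l + \<rho> l})"
      by (rule emeasure_mono) auto
    also have "\<dots> \<le> (\<Sum>l. emeasure lborel {c l - \<rho> l..c l + \<rho> l})"
      by (rule emeasure_subadditive_countably) auto
    also have "\<dots> = (\<Sum>l. ennreal 2 * ennreal (\<rho> l powr 1))"
    proof (rule suminf_cong)
      fix l
      show "emeasure lborel {c l - \<rho> l..c l + \<rho> l} = ennreal 2 * ennreal (\<rho> l powr 1)"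
        using U(1)[of l] ennreal_mult[of 2 "\<rho> l"] by (simp add: less_imp_le)
    qed
    also have "\<dots> = ennreal 2 * (\<Sum>l. ennreal (\<rho> l powr 1))"
      by (rule ennreal_suminf_cmult)
    also have "\<dots> < ennreal 2 * ennreal (L / 2)"
      using U(5) by (intro ennreal_mult_strict_left_mono) auto
    also have "\<dots> = ennreal L" using L ennreal_mult[of 2 "L / 2"] by simp
    finally show False using L by simp
  qed
  then have "ennreal 1 \<le> hausdorff_dim X" by (rule hausdorff_dim_geI)
  then show ?thesis by simp
qed

section \<open>Extending the curve to a graph\<close>

text \<open>Hausdorff's formula \<open>f x = inf\<^sub>z (f\<^sub>0 z + \<bar>x - z\<bar> / infdist x K) - 1\<close>: an extension that is locally
  Lipschitz off \<open>K\<close>, so that it adds only a set of dimension one to the graph.\<close>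

lemma lipschitz_off_closed_extension:
  fixes f0 :: "real \<Rightarrow> real" and K :: "real set"
  assumes K: "closed K" "K \<noteq> {}" "K \<subseteq> {0..1}"
    and cont: "continuous_on K f0" and bounds: "\<And>x. x \<in> K \<Longrightarrow> 0 \<le> f0 x \<and> f0 x \<le> 1"
  shows "\<exists>f. continuous_on {0..1} f \<and> (\<forall>x\<in>K. f x = f0 x) \<and>
    (\<forall>c>0. \<exists>L\<ge>0. \<forall>x\<in>{0..1}. \<forall>y\<in>{0..1}. c \<le> infdist x K \<longrightarrow> c \<le> infdist y K \<longrightarrow>
        \<bar>f x - f y\<bar> \<le> L * \<bar>x - y\<bar>)"
proof -
  define r where "r x = infdist x K" for x
  define q where "q x z = f0 z + \<bar>x - z\<bar> / r x" for x z
  define g where "g x = (INF z\<in>K. q x z)" for x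
  define f where "f x = (if x \<in> K then f0 x else g x - 1)" for x
  have r_pos: "0 < r x" if "x \<notin> K" for x
    using that K infdist_nonneg[of x K] in_closed_iff_infdist_zero[of K x] by (auto simp: r_def less_le)
  have r_le: "r x \<le> \<bar>x - z\<bar>" if "z \<in> K" for x z
    using infdist_le[OF that, of x] by (simp add: r_def dist_real_def)
  have r_nonneg: "0 \<le> r x" for x by (simp add: r_def infdist_nonneg)
  have r_lip: "r x \<le> r y + \<bar>x - y\<bar>" for x y
    using infdist_triangle[of x K y] by (simp add: r_def dist_real_def)
  have q_nonneg: "0 \<le> q x z" if "z \<in> K" for x z
    using bounds[OF that] r_nonneg[of x] by (simp add: q_def)
  have bdd: "bdd_below (q x ` K)" for x
    using q_nonneg by (auto simp: bdd_below_def)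
  have g_le: "g x \<le> q x z" if "z \<in> K" for x z
    unfolding g_def using bdd that by (rule cINF_lower)
  have g_ge: "m \<le> g x" if "\<And>z. z \<in> K \<Longrightarrow> m \<le> q x z" for m x
    unfolding g_def using K(2) that by (intro cINF_greatest) auto
  \<comment> \<open>The infima are compared term by term: for fixed \<open>z\<close>, the change of
    the numerator costs at most \<open>\<bar>x - y\<bar> / c\<close>, that of the denominator at
    most \<open>\<bar>x - y\<bar> / c\<^sup>2\<close>, since
    \<open>\<bar>y - z\<bar> \<le> 1\<close>.\<close>
  have lip1: "g x \<le> g y + (1 / c + 1 / c\<^sup>2) * \<bar>x - y\<bar>"
    if c: "0 < c" "c \<le> r x" "c \<le> r y" and xy: "x \<in> {0..1}" "y \<in> {0..1}" for x y c
  proof -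
    have "g x - (1 / c + 1 / c\<^sup>2) * \<bar>x - y\<bar> \<le> q y z" if z: "z \<in> K" for z
    proof -
      have rx: "0 < r x" "0 < r y" using c by auto
      have "\<bar>x - z\<bar> / r x - \<bar>y - z\<bar> / r y = (\<bar>x - z\<bar> - \<bar>y - z\<bar>) / r x + \<bar>y - z\<bar> * ((r y - r x) / (r x * r y))"
        using rx by (simp add: field_simps)
      also have "(\<bar>x - z\<bar> - \<bar>y - z\<bar>) / r x \<le> \<bar>x - y\<bar> / c"
        using c by (intro frac_le) auto
      also have "\<bar>y - z\<bar> * ((r y - r x) / (r x * r y)) \<le> 1 * (\<bar>x - y\<bar> / (c * c))"
      proof -
        have "(r y - r x) / (r x * r y) \<le> \<bar>x - y\<bar> / (r x * r y)"
          using r_lip[of y x] rx by (intro divide_right_mono) (auto simp: abs_minus_commute)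
        also have "\<dots> \<le> \<bar>x - y\<bar> / (c * c)"
          using c by (intro divide_left_mono mult_mono) auto
        finally have "\<bar>y - z\<bar> * ((r y - r x) / (r x * r y)) \<le> \<bar>y - z\<bar> * (\<bar>x - y\<bar> / (c * c))"
          by (rule mult_left_mono) simp
        also have "\<dots> \<le> 1 * (\<bar>x - y\<bar> / (c * c))"
        proof (rule mult_right_mono)
          show "\<bar>y - z\<bar> \<le> 1" using xy z K(3) by force
        qed (use c in auto)
        finally show ?thesis .
      qed
      finally have "\<bar>x - z\<bar> / r x - \<bar>y - z\<bar> / r y \<le> \<bar>x - y\<bar> / c + 1 * (\<bar>x - y\<bar> / (c * c))"
        by simp
      then have "q x z - q y z \<le> (1 / c + 1 / c\<^sup>2) * \<bar>x - y\<bar>"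
        by (simp add: q_def power2_eq_square algebra_simps)
      then show ?thesis using g_le[OF z, of x] by linarith
    qed
    then have "g x - (1 / c + 1 / c\<^sup>2) * \<bar>x - y\<bar> \<le> g y" by (rule g_ge)
    then show ?thesis by linarith
  qed
  have lip: "\<exists>L\<ge>0. \<forall>x\<in>{0..1}. \<forall>y\<in>{0..1}. c \<le> infdist x K \<longrightarrow> c \<le> infdist y K \<longrightarrow>
        \<bar>f x - f y\<bar> \<le> L * \<bar>x - y\<bar>" if "c > 0" for c
  proof (intro exI[of _ "1 / c + 1 / c\<^sup>2"] conjI ballI impI)
    show "0 \<le> 1 / c + 1 / c\<^sup>2" using that by simp
    fix x y :: real assume xy: "x \<in> {0..1}" "y \<in> {0..1}" and "c \<le> infdist x K" "c \<le> infdist y K"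
    then have r: "c \<le> r x" "c \<le> r y" by (simp_all add: r_def)
    then have "x \<notin> K" "y \<notin> K" using that r_le[of x x] r_le[of y y] by auto
    then show "\<bar>f x - f y\<bar> \<le> (1 / c + 1 / c\<^sup>2) * \<bar>x - y\<bar>"
      using lip1[OF that r xy] lip1[OF that r(2,1) xy(2,1)]
      by (simp add: f_def abs_minus_commute[of x y] abs_le_iff)
  qed
  have "continuous_on {0..1} f"
    unfolding continuous_on_iff
  proof (intro ballI allI impI)
    fix a e :: real assume a: "a \<in> {0..1}" and e: "0 < e"
    show "\<exists>d>0. \<forall>x\<in>{0..1}. dist x a < d \<longrightarrow> dist (f x) (f a) < e"
    proof (cases "a \<in> K")
      case False
      define c where "c = r a / 2"
      have c: "0 < c" using r_pos[OF False] by (simp add: c_def)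
      obtain L where L: "L \<ge> 0" "\<And>x y. x \<in> {0..1} \<Longrightarrow> y \<in> {0..1} \<Longrightarrow> c \<le> r x \<Longrightarrow> c \<le> r y \<Longrightarrow>
          \<bar>f x - f y\<bar> \<le> L * \<bar>x - y\<bar>"
        using lip[OF c] by (auto simp: r_def)
      show ?thesis
      proof (intro exI[of _ "min c (e / (L + 1))"] conjI ballI impI)
        show "0 < min c (e / (L + 1))" using c e L by simp
        fix x :: real assume x: "x \<in> {0..1}" "dist x a < min c (e / (L + 1))"
        then have xa: "\<bar>x - a\<bar> < c" "\<bar>x - a\<bar> < e / (L + 1)" by (auto simp: dist_real_def)
        then have "c \<le> r x" using r_lip[of a x] by (simp add: c_def abs_minus_commute)
        then have "\<bar>f x - f a\<bar> \<le> L * \<bar>x - a\<bar>"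
          using L(2)[of x a] x a c by (simp add: c_def)
        also have "\<dots> \<le> (L + 1) * \<bar>x - a\<bar>" by (intro mult_right_mono) auto
        also have "\<dots> < e" using xa(2) L by (simp add: field_simps)
        finally show "dist (f x) (f a) < e" by (simp add: dist_real_def)
      qed
    next
      case True
      obtain d where d: "d > 0" "\<And>z. z \<in> K \<Longrightarrow> \<bar>z - a\<bar> < d \<Longrightarrow> \<bar>f0 z - f0 a\<bar> < e / 2"
        using cont True e unfolding continuous_on_iff dist_real_def by (meson half_gt_zero)
      show ?thesis
      proof (intro exI[of _ "d / 3"] conjI ballI impI)
        show "0 < d / 3" using d by simp
        fix x :: real assume x: "x \<in> {0..1}" "dist x a < d / 3"
        then have xa: "\<bar>x - a\<bar> < d / 3" by (simp add: dist_real_def)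
        show "dist (f x) (f a) < e"
        proof (cases "x \<in> K")
          case x_in: True
          then show ?thesis
            using d(2)[OF x_in] xa d(1) True e by (simp add: f_def dist_real_def)
        next
          case False
          have rx: "0 < r x" "r x \<le> \<bar>x - a\<bar>" using r_pos[OF False] r_le[OF True] by auto
          \<comment> \<open>At a nearest point of \<open>K\<close> the quotient is exactly 1, which
            is why 1 is subtracted in \<open>f\<close>.\<close>
          obtain z where z: "z \<in> K" "r x = \<bar>x - z\<bar>"
            using infdist_attains_inf[OF K(1,2), of x] by (auto simp: r_def dist_real_def)
          have "\<bar>z - a\<bar> < d" using z(2) rx xa d(1) by linarith
          then have "f0 z < f0 a + e / 2" using d(2)[OF z(1)] by linarith
          moreover have "q x z = f0 z + 1" using z(2) rx(1) by (simp add: q_def)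
          ultimately have up: "g x - 1 < f0 a + e / 2" using g_le[OF z(1), of x] by linarith
          have "f0 a - e / 2 + 1 \<le> q x w" if w: "w \<in> K" for w
          proof (cases "\<bar>w - a\<bar> < d")
            case True
            then have "f0 a - e / 2 \<le> f0 w" using d(2)[OF w] by linarith
            moreover have "1 \<le> \<bar>x - w\<bar> / r x" using r_le[OF w, of x] rx(1) by simp
            ultimately show ?thesis by (simp add: q_def)
          next
            case far: False
            \<comment> \<open>Points of \<open>K\<close> far from \<open>a\<close> have quotient at
              least 2 and cannot undercut, since \<open>f0\<close> takes values in
              \<open>{0..1}\<close>.\<close>
            have "2 * r x \<le> \<bar>x - w\<bar>" using far xa rx(2) by linarith
            then have "2 \<le> \<bar>x - w\<bar> / r x" using rx(1) by (simp add: field_simps)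
            then show ?thesis using bounds[OF w] bounds[OF True] e unfolding q_def by linarith
          qed
          then have "f0 a - e / 2 + 1 \<le> g x" by (rule g_ge)
          with up show ?thesis
            using False True e by (simp add: f_def dist_real_def abs_less_iff)
        qed
      qed
    qed
  qed
  then show ?thesis
    using lip by (intro exI[of _ f]) (simp add: f_def)
qed

section \<open>The curve as a graph over a closed set\<close>

text \<open>Such abscissas share their digits below \<open>enc k\<close>, and the positions
  \<open>enc l\<close> with \<open>l < k\<close> among these record the first \<open>k\<close>
  digits of the ordinate.\<close>

lemma curve_fst_determines:
  assumes "p \<in> cantor_curve t" "q \<in> cantor_curve t" "\<bar>fst p - fst q\<bar> < 1 / 2 ^ Suc (enc k)"
  shows "\<bar>snd p - snd q\<bar> \<le> 1 / 2 ^ k"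
proof -
  obtain C R C' R' where p: "p = curve_point C R" "C \<subseteq> free_pos t"
    and q: "q = curve_point C' R'" "C' \<subseteq> free_pos t"
    using assms by (auto simp: cantor_curve_def)
  have dis: "C \<inter> enc_pos = {}" "C' \<inter> enc_pos = {}"
    using p q free_pos_disjoint by blast+
  have eq: "join C R \<inter> {..<enc k} = join C' R' \<inter> {..<enc k}"
    by (rule join_separation[OF dis]) (use assms(3) p q in \<open>simp add: curve_point_def\<close>)
  have "l \<in> R \<longleftrightarrow> l \<in> R'" if "l < k" for l
  proof -
    have "enc l < enc k" using that enc_mono by (simp add: strict_mono_less)
    with eq have "enc l \<in> join C R \<longleftrightarrow> enc l \<in> join C' R'" by blast
    then show ?thesis by (simp add: enc_in_join dis)
  qed
  then have "R \<inter> {..<k} = R' \<inter> {..<k}" by auto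
  then show ?thesis
    using binval_close p q by (simp add: curve_point_def)
qed

text \<open>On the projection of the curve the ordinate is a uniformly continuous function of the
  abscissa, so it extends to the closure; the added graph points are limits of curve points.\<close>

lemma curve_function:
  obtains K f0 where "closed K" "K \<noteq> {}" "K \<subseteq> {0..1::real}" "continuous_on K f0"
    "\<And>x. x \<in> K \<Longrightarrow> 0 \<le> f0 x \<and> f0 x \<le> (1::real)"
    "\<And>p. p \<in> cantor_curve t \<Longrightarrow> fst p \<in> K \<and> f0 (fst p) = snd p"
    "\<And>x. x \<in> K \<Longrightarrow> (x, f0 x) \<in> closure (cantor_curve t)"
proof -
  define K0 where "K0 = fst ` cantor_curve t"
  define h where "h x = snd (SOME p. p \<in> cantor_curve t \<and> fst p = x)" for x
  have some: "\<exists>p\<in>cantor_curve t. fst p = x \<and> snd p = h x" if "x \<in> K0" for x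
  proof -
    have "\<exists>p. p \<in> cantor_curve t \<and> fst p = x" using that by (auto simp: K0_def)
    from someI_ex[OF this] show ?thesis by (auto simp: h_def)
  qed
  have uc: "uniformly_continuous_on K0 h"
    unfolding uniformly_continuous_on_def
  proof (intro allI impI)
    fix e :: real assume "0 < e"
    then obtain k where k: "(1/2) ^ k < e" using real_arch_pow_inv[of e "1/2"] by auto
    show "\<exists>d>0. \<forall>x\<in>K0. \<forall>x'\<in>K0. dist x' x < d \<longrightarrow> dist (h x') (h x) < e"
    proof (intro exI[of _ "1 / 2 ^ Suc (enc k)"] conjI ballI impI)
      fix x x' assume "x \<in> K0" "x' \<in> K0" and less: "dist x' x < 1 / 2 ^ Suc (enc k)"
      then obtain p p' where "p \<in> cantor_curve t" "fst p = x" "snd p = h x"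
        "p' \<in> cantor_curve t" "fst p' = x'" "snd p' = h x'"
        using some by metis
      with less curve_fst_determines[of p' t p k] show "dist (h x') (h x) < e"
        using k by (simp add: dist_real_def power_one_over)
    qed simp
  qed
  obtain f0 where f0: "uniformly_continuous_on (closure K0) f0" "\<And>x. x \<in> K0 \<Longrightarrow> h x = f0 x"
    by (rule uniformly_continuous_on_extension_on_closure[OF uc], rule that, assumption, metis)
  have cont: "continuous_on (closure K0) f0"
    using f0(1) by (rule uniformly_continuous_imp_continuous)
  have box: "cantor_curve t \<subseteq> {0..1} \<times> {0..1}"
    by (auto simp: cantor_curve_def curve_point_def binval_nonneg binval_le_1)
  have in_closure: "(x, f0 x) \<in> closure (cantor_curve t)" if x: "x \<in> closure K0" for x
  proof -
    obtain \<xi> where \<xi>: "\<And>n. \<xi> n \<in> K0" "\<xi> \<longlonglongrightarrow> x"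
      using x by (auto simp: closure_sequential)
    have "(\<lambda>n. f0 (\<xi> n)) \<longlonglongrightarrow> f0 x"
      using cont x \<xi> closure_subset[of K0] unfolding continuous_on_sequentially comp_def by blast
    then have "(\<lambda>n. (\<xi> n, f0 (\<xi> n))) \<longlonglongrightarrow> (x, f0 x)"
      using \<xi>(2) by (intro tendsto_Pair)
    moreover have "(\<xi> n, f0 (\<xi> n)) \<in> cantor_curve t" for n
      using some[OF \<xi>(1)[of n]] f0(2)[OF \<xi>(1)[of n]] by (metis prod.collapse)
    ultimately show ?thesis
      unfolding closure_sequential by (intro exI[of _ "\<lambda>n. (\<xi> n, f0 (\<xi> n))"] conjI allI)
  qed
  have box': "closure (cantor_curve t) \<subseteq> {0..1} \<times> {0..1}"
    using box by (intro closure_minimal closed_Times) auto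
  show ?thesis
  proof (rule that[of "closure K0" f0])
    have "curve_point {} {} \<in> cantor_curve t" by (rule curve_point_in) simp
    then show "closure K0 \<noteq> {}" by (auto simp: K0_def)
    show "closure K0 \<subseteq> {0..1}"
      using box by (intro closure_minimal) (auto simp: K0_def)
  next
    fix x assume "x \<in> closure K0"
    with in_closure box' show "0 \<le> f0 x \<and> f0 x \<le> 1" by fastforce
  next
    fix p assume p: "p \<in> cantor_curve t"
    then have fp: "fst p \<in> K0" by (simp add: K0_def)
    then obtain q where q: "q \<in> cantor_curve t" "fst q = fst p" "snd q = h (fst p)"
      using some by blast
    \<comment> \<open>\<open>h\<close> picks some curve point over each abscissa; the estimate for
      all \<open>k\<close> shows that there is only one.\<close>
    have "\<bar>snd q - snd p\<bar> \<le> (1/2) ^ k" for k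
      using curve_fst_determines[OF q(1) p, of k] q(2) by (simp add: power_one_over)
    moreover have "\<exists>k. (1/2) ^ k < \<bar>snd q - snd p\<bar>" if "0 < \<bar>snd q - snd p\<bar>"
      using real_arch_pow_inv[OF that, of "1/2"] by simp
    ultimately have "\<not> 0 < \<bar>snd q - snd p\<bar>"
      by (meson not_less)
    then show "fst p \<in> closure K0 \<and> f0 (fst p) = snd p"
      using q(3) f0(2)[OF fp] fp closure_subset[of K0] by auto
  qed (use cont in_closure in auto)
qed

section \<open>Fine covers of the curve and of Lipschitz pieces\<close>

text \<open>The expression equals \<open>c powr s * (2 powr (a - s)) ^ n\<close>, a geometric
  sequence tending to 0.\<close>

lemma dyadic_cover_small:
  fixes a s c \<epsilon> :: real
  assumes "a < s" "0 < c" "0 < \<epsilon>"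
  shows "\<exists>n. 2 powr (real n * a) * (c / 2 ^ n) powr s < \<epsilon>"
proof -
  have "2 powr (a - s) < 2 powr 0" using assms by (intro powr_less_mono) auto
  then obtain n where n: "(2 powr (a - s)) ^ n < \<epsilon> / c powr s"
    using real_arch_pow_inv[of "\<epsilon> / c powr s" "2 powr (a - s)"] assms by auto
  have "2 powr (real n * a) * (c / 2 ^ n) powr s = c powr s * (2 powr (a - s)) ^ n"
    using assms(2)
    by (simp add: powr_divide powr_powr powr_diff right_diff_distrib mult.commute flip: powr_realpow)
  also have "\<dots> < \<epsilon>" using n assms(2) by (simp add: field_simps)
  finally show ?thesis by blast
qed

text \<open>A box-counting form of null \<open>s\<close>-measure: all members of a family share one
  size bound. They are sets in the plane and are intersected with the graph only in
  \<open>hausdorff_measure_graph_eq_0\<close>.\<close>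

definition finely_covered :: "real \<Rightarrow> (real \<times> real) set \<Rightarrow> bool" where
  "finely_covered s B \<longleftrightarrow> (\<forall>\<epsilon>>0. \<exists>\<V> \<rho>. finite \<V> \<and> 0 \<le> \<rho> \<and>
      (\<forall>V\<in>\<V>. \<forall>x\<in>V. \<forall>y\<in>V. dist x y \<le> \<rho>) \<and> B \<subseteq> \<Union>\<V> \<and> real (card \<V>) * \<rho> powr s < \<epsilon>)"

text \<open>One ball per level \<open>n\<close> cell: at most \<open>n * t\<close> free digits and
  \<open>n\<close> ordinate digits give at most \<open>2 powr (n * (1 + t))\<close> balls. As the
  balls are closed, their finite union contains the closure too.\<close>

lemma finely_covered_closure_curve:
  assumes t: "0 \<le> t" "t \<le> 1" and s: "1 + t < s"
  shows "finely_covered s (closure (cantor_curve t))"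
  unfolding finely_covered_def
proof (intro allI impI)
  fix \<epsilon> :: real assume "0 < \<epsilon>"
  then obtain n where n: "2 powr (real n * (1 + t)) * (4 / 2 ^ n) powr s < \<epsilon>"
    using dyadic_cover_small[OF s, of 4] by auto
  let ?N = "Pow (free_pos t \<inter> {..<n}) \<times> Pow {..<n}"
  define \<V> where "\<V> = (\<lambda>(C, R). cball (curve_point C R) (2 / 2 ^ n)) ` ?N"
  have fin: "finite \<V>" by (simp add: \<V>_def)
  have "card \<V> \<le> card ?N" unfolding \<V>_def by (rule card_image_le) simp
  also have "card ?N = 2 ^ (card (free_pos t \<inter> {..<n}) + n)"
    by (simp add: card_cartesian_product card_Pow power_add del: Pow_Int_eq)
  finally have "real (card \<V>) \<le> 2 ^ (card (free_pos t \<inter> {..<n}) + n)"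
    by (metis of_nat_le_iff of_nat_numeral of_nat_power)
  also have "\<dots> = 2 powr (real (card (free_pos t \<inter> {..<n})) + real n)"
    by (simp flip: powr_realpow)
  also have "\<dots> \<le> 2 powr (real n * (1 + t))"
    using card_free_pos_le[OF t, of n] by (intro powr_mono) (auto simp: algebra_simps)
  finally have "real (card \<V>) * (4 / 2 ^ n) powr s \<le> 2 powr (real n * (1 + t)) * (4 / 2 ^ n) powr s"
    by (rule mult_right_mono) simp
  with n have card: "real (card \<V>) * (4 / 2 ^ n) powr s < \<epsilon>" by linarith
  have "cantor_curve t \<subseteq> \<Union>\<V>"
  proof
    fix p assume "p \<in> cantor_curve t"
    then obtain C R where p: "p = curve_point C R" "C \<subseteq> free_pos t"
      by (auto simp: cantor_curve_def)
    have "dist (curve_point (C \<inter> {..<n}) (R \<inter> {..<n})) p \<le> 2 / 2 ^ n"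
      unfolding p(1) by (rule dist_curve_point) auto
    moreover have "cball (curve_point (C \<inter> {..<n}) (R \<inter> {..<n})) (2 / 2 ^ n) \<in> \<V>"
      unfolding \<V>_def using p(2) by (intro image_eqI[of _ _ "(C \<inter> {..<n}, R \<inter> {..<n})"]) auto
    ultimately show "p \<in> \<Union>\<V>" by (meson UnionI mem_cball)
  qed
  moreover have "closed (\<Union>\<V>)" using fin by (intro closed_Union) (auto simp: \<V>_def)
  ultimately have sub: "closure (cantor_curve t) \<subseteq> \<Union>\<V>" by (rule closure_minimal)
  have "dist x y \<le> 4 / 2 ^ n" if V: "V \<in> \<V>" "x \<in> V" "y \<in> V" for V x y
  proof -
    obtain C R where "V = cball (curve_point C R) (2 / 2 ^ n)" using V(1) by (auto simp: \<V>_def)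
    with V show ?thesis using dist_triangle3[of x y "curve_point C R"] by simp
  qed
  with fin card sub show "\<exists>\<V> \<rho>. finite \<V> \<and> 0 \<le> \<rho> \<and>
      (\<forall>V\<in>\<V>. \<forall>x\<in>V. \<forall>y\<in>V. dist x y \<le> \<rho>) \<and> closure (cantor_curve t) \<subseteq> \<Union>\<V> \<and> real (card \<V>) * \<rho> powr s < \<epsilon>"
    by (intro exI[of _ \<V>] exI[of _ "4 / 2 ^ n"]) auto
qed

text \<open>Vertical strips of width \<open>1 / 2 ^ n\<close> cut the graph into pieces of diameter
  at most \<open>(1 + L) / 2 ^ n\<close>.\<close>

lemma finely_covered_lipschitz_graph:
  assumes S: "S \<subseteq> {0..1}" and L: "0 \<le> L"
    and lip: "\<And>x y. x \<in> S \<Longrightarrow> y \<in> S \<Longrightarrow> \<bar>f x - f y\<bar> \<le> L * \<bar>x - y\<bar>" and s: "1 < s"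
  shows "finely_covered s {(x, f x) |x. x \<in> S}"
  unfolding finely_covered_def
proof (intro allI impI)
  fix \<epsilon> :: real assume "0 < \<epsilon>"
  then obtain n where "2 powr (real n * 1) * ((1 + L) / 2 ^ n) powr s < \<epsilon> / 2"
    using dyadic_cover_small[OF s, of "1 + L" "\<epsilon> / 2"] L by auto
  then have n: "2 * 2 ^ n * ((1 + L) / 2 ^ n) powr s < \<epsilon>"
    by (simp add: powr_realpow)
  define V where "V i = {(x, f x) |x. x \<in> S \<and> real i \<le> x * 2 ^ n \<and> x * 2 ^ n \<le> real i + 1}" for i :: nat
  \<comment> \<open>The index \<open>2 ^ n\<close> serves the right end \<open>x = 1\<close>; the
    count \<open>2 ^ n + 1\<close> is absorbed by the factor 2.\<close>
  define \<V> where "\<V> = V ` {..2 ^ n}"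
  have fin: "finite \<V>" by (simp add: \<V>_def)
  have "card \<V> \<le> card {..2 ^ n :: nat}" unfolding \<V>_def by (rule card_image_le) simp
  also have "\<dots> \<le> 2 * 2 ^ n" by simp
  finally have "real (card \<V>) \<le> 2 * 2 ^ n"
    by (metis of_nat_le_iff of_nat_mult of_nat_numeral of_nat_power)
  then have "real (card \<V>) * ((1 + L) / 2 ^ n) powr s \<le> 2 * 2 ^ n * ((1 + L) / 2 ^ n) powr s"
    by (rule mult_right_mono) simp
  with n have card: "real (card \<V>) * ((1 + L) / 2 ^ n) powr s < \<epsilon>" by linarith
  have sub: "{(x, f x) |x. x \<in> S} \<subseteq> \<Union>\<V>"
  proof clarify
    fix x assume x: "x \<in> S"
    define i where "i = nat \<lfloor>x * 2 ^ n\<rfloor>"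
    have x01: "0 \<le> x" "x \<le> 1" using x S by auto
    have i: "real i \<le> x * 2 ^ n" "x * 2 ^ n \<le> real i + 1"
      using x01 by (auto simp: i_def)
    have "x * 2 ^ n \<le> 1 * 2 ^ n" using x01 by (intro mult_right_mono) auto
    with i(1) have "real i \<le> real (2 ^ n)" unfolding of_nat_power of_nat_numeral by linarith
    then have "i \<le> 2 ^ n" by (simp only: of_nat_le_iff)
    then show "(x, f x) \<in> \<Union>\<V>" using x i by (auto simp: \<V>_def V_def)
  qed
  have "dist p q \<le> (1 + L) / 2 ^ n" if W: "W \<in> \<V>" "p \<in> W" "q \<in> W" for W p q
  proof -
    obtain i x y where xy: "p = (x, f x)" "q = (y, f y)" "x \<in> S" "y \<in> S"
        "real i \<le> x * 2 ^ n" "x * 2 ^ n \<le> real i + 1" "real i \<le> y * 2 ^ n" "y * 2 ^ n \<le> real i + 1"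
      using W by (auto simp: \<V>_def V_def)
    have "\<bar>x * 2 ^ n - y * 2 ^ n\<bar> \<le> 1" using xy by linarith
    then have "\<bar>x - y\<bar> * 2 ^ n \<le> 1"
      by (simp add: abs_mult flip: left_diff_distrib)
    then have "\<bar>x - y\<bar> \<le> 1 / 2 ^ n" by (simp add: field_simps)
    have "dist p q \<le> \<bar>x - y\<bar> + \<bar>f x - f y\<bar>"
      using dist_le_coords[of p q] xy by simp
    also have "\<dots> \<le> (1 + L) * \<bar>x - y\<bar>"
      using lip[OF xy(3,4)] by (simp add: algebra_simps)
    also have "\<dots> \<le> (1 + L) * (1 / 2 ^ n)"
      using L \<open>\<bar>x - y\<bar> \<le> 1 / 2 ^ n\<close> by (intro mult_left_mono) auto
    finally show ?thesis by simp
  qed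
  with fin card sub L show "\<exists>\<V> \<rho>. finite \<V> \<and> 0 \<le> \<rho> \<and>
      (\<forall>V\<in>\<V>. \<forall>x\<in>V. \<forall>y\<in>V. dist x y \<le> \<rho>) \<and> {(x, f x) |x. x \<in> S} \<subseteq> \<Union>\<V> \<and> real (card \<V>) * \<rho> powr s < \<epsilon>"
    by (intro exI[of _ \<V>] exI[of _ "(1 + L) / 2 ^ n"]) auto
qed

section \<open>Graphs of minimal conformal dimension\<close>

lemma mspace_graph_metric [simp]: "mspace (graph_metric f) = {(x, f x) |x. x \<in> {0..1}}"
  by (simp add: graph_metric_def)

lemma mdist_graph_metric [simp]: "mdist (graph_metric f) = dist"
  by (simp add: graph_metric_def)

lemma mtopology_of_graph_metric:
  "mtopology_of (graph_metric f) = top_of_set {(x, f x) |x. x \<in> {0..1}}"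
  by (simp add: graph_metric_def mtopology_of_submetric)

lemma hausdorff_measure_graph_eq_0:
  fixes B :: "nat \<Rightarrow> (real \<times> real) set"
  assumes s: "0 < s" and cov: "mspace (graph_metric f) \<subseteq> (\<Union>k. B k)"
    and fine: "\<And>k. finely_covered s (B k)"
  shows "hausdorff_measure (graph_metric f) s (mspace (graph_metric f)) = 0"
proof (rule hausdorff_measure_eq_0I[of s _ "\<lambda>k. B k \<inter> mspace (graph_metric f)"])
  fix k and \<epsilon> :: real
  assume "0 < \<epsilon>"
  then obtain \<V> \<rho> where V: "finite \<V>" "0 \<le> \<rho>" "\<forall>V\<in>\<V>. \<forall>x\<in>V. \<forall>y\<in>V. dist x y \<le> \<rho>" "B k \<subseteq> \<Union>\<V>"
      "real (card \<V>) * \<rho> powr s < \<epsilon>"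
    using fine[of k] unfolding finely_covered_def by meson
  let ?W = "(\<lambda>V. V \<inter> mspace (graph_metric f)) ` \<V>"
  have "real (card ?W) * \<rho> powr s \<le> real (card \<V>) * \<rho> powr s"
    using V(1) by (intro mult_right_mono) (auto intro: card_image_le)
  then have "real (card ?W) * \<rho> powr s < \<epsilon>" using V(5) by linarith
  moreover have "\<forall>V\<in>?W. V \<subseteq> mspace (graph_metric f) \<and> (\<forall>x\<in>V. \<forall>y\<in>V. mdist (graph_metric f) x y \<le> \<rho>)"
    using V(3) by auto
  moreover have "B k \<inter> mspace (graph_metric f) \<subseteq> \<Union>?W" using V(4) by blast
  ultimately show "\<exists>\<V> \<rho>. finite \<V> \<and> 0 \<le> \<rho> \<and>
      (\<forall>V\<in>\<V>. V \<subseteq> mspace (graph_metric f) \<and> (\<forall>x\<in>V. \<forall>y\<in>V. mdist (graph_metric f) x y \<le> \<rho>)) \<and>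
      B k \<inter> mspace (graph_metric f) \<subseteq> \<Union>\<V> \<and> real (card \<V>) * \<rho> powr s < \<epsilon>"
    using V(1,2) by (intro exI[of _ ?W] exI[of _ \<rho>]) blast
qed (use s cov in auto)

text \<open>Over \<open>K\<close> the graph lies in the closure of the curve; off \<open>K\<close>
  it is a countable union of Lipschitz graphs over the sets \<open>S k\<close>. Both kinds of pieces
  are finely covered for every \<open>s > 1 + t\<close>.\<close>

lemma graph_through_curve:
  assumes t: "0 \<le> t" "t \<le> 1"
  obtains f where "continuous_on {0..1} f" "cantor_curve t \<subseteq> mspace (graph_metric f)"
    "hausdorff_dim (graph_metric f) \<le> ennreal (1 + t)"
proof -
  obtain K f0 where K: "closed K" "K \<noteq> {}" "K \<subseteq> {0..1::real}" "continuous_on K f0"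
    and bounds: "\<And>x. x \<in> K \<Longrightarrow> 0 \<le> f0 x \<and> f0 x \<le> (1::real)"
    and curve: "\<And>p. p \<in> cantor_curve t \<Longrightarrow> fst p \<in> K \<and> f0 (fst p) = snd p"
    and closure: "\<And>x. x \<in> K \<Longrightarrow> (x, f0 x) \<in> closure (cantor_curve t)"
    by (rule curve_function[of t], rule that)
  obtain f where f: "continuous_on {0..1} f" "\<And>x. x \<in> K \<Longrightarrow> f x = f0 x"
    and lip: "\<And>c. c > 0 \<Longrightarrow> \<exists>L\<ge>0. \<forall>x\<in>{0..1}. \<forall>y\<in>{0..1}. c \<le> infdist x K \<longrightarrow> c \<le> infdist y K \<longrightarrow>
        \<bar>f x - f y\<bar> \<le> L * \<bar>x - y\<bar>"
    using lipschitz_off_closed_extension[OF K bounds] by blast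
  show ?thesis
  proof (rule that[OF f(1)])
    show "cantor_curve t \<subseteq> mspace (graph_metric f)"
    proof
      fix p assume "p \<in> cantor_curve t"
      with curve have "fst p \<in> K" "f0 (fst p) = snd p" by auto
      then show "p \<in> mspace (graph_metric f)"
        using f(2)[of "fst p"] K(3) by (auto intro!: exI[of _ "fst p"] simp: prod_eq_iff)
    qed
    show "hausdorff_dim (graph_metric f) \<le> ennreal (1 + t)"
    proof (rule hausdorff_dim_leI)
      fix s assume s: "1 + t < s"
      define S where "S k = {x \<in> {0..1}. 1 / real (Suc k) \<le> infdist x K}" for k
      define B where "B k = (case k of 0 \<Rightarrow> closure (cantor_curve t) | Suc k \<Rightarrow> {(x, f x) |x. x \<in> S k})" for k
      show "hausdorff_measure (graph_metric f) s (mspace (graph_metric f)) = 0"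
      proof (rule hausdorff_measure_graph_eq_0)
        show "0 < s" using s t by simp
        show "mspace (graph_metric f) \<subseteq> (\<Union>k. B k)"
        proof
          fix p assume "p \<in> mspace (graph_metric f)"
          then obtain x where x: "x \<in> {0..1}" "p = (x, f x)" by auto
          show "p \<in> (\<Union>k. B k)"
          proof (cases "x \<in> K")
            case True
            then have "p \<in> B 0" using closure f(2) x by (simp add: B_def)
            then show ?thesis by blast
          next
            case False
            then have "0 < infdist x K"
              using K in_closed_iff_infdist_zero[of K x] infdist_nonneg[of x K] by (auto simp: less_le)
            then obtain k where "1 / real (Suc k) < infdist x K"
              using reals_Archimedean[of "infdist x K"] by (auto simp: inverse_eq_divide)
            then have "p \<in> B (Suc k)" using x by (auto simp: B_def S_def)
            then show ?thesis by blast
          qed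
        qed
        show "finely_covered s (B k)" for k
        proof (cases k)
          case 0
          then show ?thesis using finely_covered_closure_curve[OF t s] by (simp add: B_def)
        next
          case (Suc k)
          obtain L where L: "L \<ge> 0" "\<And>x y. x \<in> S k \<Longrightarrow> y \<in> S k \<Longrightarrow> \<bar>f x - f y\<bar> \<le> L * \<bar>x - y\<bar>"
            using lip[of "1 / real (Suc k)"] by (auto simp: S_def)
          have "finely_covered s {(x, f x) |x. x \<in> S k}"
            by (rule finely_covered_lipschitz_graph[OF _ L]) (use s t in \<open>auto simp: S_def\<close>)
          with Suc show ?thesis by (simp add: B_def)
        qed
      qed
    qed (use t in auto)
  qed
qed

lemma qs_image_graph:
  fixes Y :: "'b metric"
  assumes t: "0 \<le> t" "t \<le> 1" and sub: "cantor_curve t \<subseteq> mspace (graph_metric f)"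
    and qs: "quasisymmetric_homeo (graph_metric f) Y g"
  shows "qs_image t (\<lambda>p q. mdist Y (g p) (g q))"
proof -
  let ?X = "graph_metric f"
  interpret Y: Metric_space "mspace Y" "mdist Y" by (rule Metric_space_mspace_mdist)
  have hom: "homeomorphic_map (mtopology_of ?X) (mtopology_of Y) g"
    using qs by (simp add: quasisymmetric_homeo_def)
  have "bij_betw g (mspace ?X) (mspace Y)"
    using hom by (metis homeomorphic_eq_everything_map bij_betw_def topspace_mtopology_of)
  then have gin: "g p \<in> mspace Y" and inj: "q \<in> mspace ?X \<Longrightarrow> g p = g q \<longleftrightarrow> p = q"
    if "p \<in> mspace ?X" for p q
    using that unfolding bij_betw_def inj_on_def by blast+
  have inX: "p \<in> mspace ?X" if "p \<in> cantor_curve t" for p using sub that by blast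
  interpret Metric_space "cantor_curve t" "\<lambda>p q. mdist Y (g p) (g q)"
    by unfold_locales (simp_all add: inX gin inj Y.commute Y.triangle del: mspace_graph_metric)
  show ?thesis
  proof unfold_locales
    show "0 \<le> t" "t \<le> 1" by fact+
  next
    fix T
    obtain \<eta> \<eta>' where \<eta>: "homeomorphism {0..} {0..} \<eta> (\<eta>' :: real \<Rightarrow> real)"
      "\<forall>x\<in>mspace ?X. \<forall>y\<in>mspace ?X. \<forall>z\<in>mspace ?X. x \<noteq> z \<longrightarrow>
          mdist Y (g x) (g y) / mdist Y (g x) (g z) \<le> \<eta> (mdist ?X x y / mdist ?X x z)"
      using qs unfolding quasisymmetric_homeo_def by blast
    \<comment> \<open>A bound for \<open>\<eta>\<close> on the compact interval
      \<open>{0..T}\<close> serves as the constant for the ratio bound \<open>T\<close>.\<close>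
    have "continuous_on {0..T} \<eta>"
      using \<eta>(1) by (auto simp: homeomorphism_def intro: continuous_on_subset)
    then have "bounded (\<eta> ` {0..T})"
      by (intro compact_imp_bounded compact_continuous_image) auto
    then obtain H where "\<forall>y\<in>\<eta> ` {0..T}. norm y \<le> H"
      unfolding bounded_iff by blast
    then have H: "\<bar>\<eta> r\<bar> \<le> H" if "r \<in> {0..T}" for r
      using that by auto
    have "mdist Y (g p) (g q) \<le> H * mdist Y (g p) (g r)"
      if p: "p \<in> cantor_curve t" "q \<in> cantor_curve t" "r \<in> cantor_curve t" "p \<noteq> r"
        "dist p q \<le> T * dist p r" for p q r
    proof -
      have pos: "0 < mdist Y (g p) (g r)"
        using p inX gin inj[of p r] by (intro Y.mdist_pos_less) auto
      have "mdist Y (g p) (g q) / mdist Y (g p) (g r) \<le> \<eta> (dist p q / dist p r)"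
        using \<eta>(2) inX p by (metis mdist_graph_metric)
      also have "\<dots> \<le> H"
        using H[of "dist p q / dist p r"] p(4,5) by (simp add: field_simps abs_le_iff)
      finally show ?thesis using pos by (simp add: field_simps)
    qed
    then show "\<exists>H. \<forall>p\<in>cantor_curve t. \<forall>q\<in>cantor_curve t. \<forall>r\<in>cantor_curve t.
        p \<noteq> r \<longrightarrow> dist p q \<le> T * dist p r \<longrightarrow> mdist Y (g p) (g q) \<le> H * mdist Y (g p) (g r)"
      by blast
  next
    fix p and \<epsilon> :: real assume p: "p \<in> cantor_curve t" and \<epsilon>: "0 < \<epsilon>"
    interpret X: Metric_space "mspace ?X" "mdist ?X" by (rule Metric_space_mspace_mdist)
    have "continuous_map X.mtopology Y.mtopology g"
      using homeomorphic_imp_continuous_map[OF hom] by (simp add: mtopology_of_def)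
    then have "\<forall>a\<in>mspace ?X. \<forall>\<epsilon>>0. \<exists>\<tau>>0. \<forall>q. q \<in> mspace ?X \<and> mdist ?X a q < \<tau> \<longrightarrow>
        mdist Y (g a) (g q) < \<epsilon>"
      unfolding X.metric_continuous_map[OF Metric_space_mspace_mdist] by (rule conjunct2)
    from this[rule_format, OF inX[OF p] \<epsilon>] obtain \<tau> where
      "\<tau> > 0" "\<forall>q. q \<in> mspace ?X \<and> mdist ?X p q < \<tau> \<longrightarrow> mdist Y (g p) (g q) < \<epsilon>" by blast
    then show "\<exists>\<tau>>0. \<forall>q\<in>cantor_curve t. dist p q < \<tau> \<longrightarrow> mdist Y (g p) (g q) < \<epsilon>"
      using inX by (metis mdist_graph_metric)
  qed
qed

text \<open>For \<open>t > 0\<close> a null cover of \<open>Y\<close> pulls back to a cover of all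
  parameters that \<open>no_small_cover\<close> excludes. For \<open>t = 0\<close> no exponent
  satisfies \<open>1 \<le> s < 1 + t\<close>, and connectedness gives the bound 1.\<close>

lemma hausdorff_dim_qs_graph_ge:
  fixes Y :: "'b metric"
  assumes t: "0 \<le> t" "t \<le> 1" and sub: "cantor_curve t \<subseteq> mspace (graph_metric f)"
    and cont: "continuous_on {0..1} f" and qs: "quasisymmetric_homeo (graph_metric f) Y g"
  shows "ennreal (1 + t) \<le> hausdorff_dim Y"
proof (cases "t = 0")
  case True
  let ?\<Gamma> = "{(x, f x) |x. x \<in> {0..1}}"
  have hom: "homeomorphic_map (mtopology_of (graph_metric f)) (mtopology_of Y) g"
    using qs by (simp add: quasisymmetric_homeo_def)
  have "?\<Gamma> = (\<lambda>x. (x, f x)) ` {0..1}" by auto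
  then have "connected ?\<Gamma>"
    using cont by (auto intro!: connected_continuous_image continuous_intros)
  then have "connected_space (mtopology_of (graph_metric f))"
    by (simp add: mtopology_of_graph_metric connected_space_subtopology)
  then have "connected_space (mtopology_of Y)"
    using homeomorphic_connected_space[OF homeomorphic_map_imp_homeomorphic_space[OF hom]] by simp
  moreover have bij: "bij_betw g ?\<Gamma> (mspace Y)"
    using hom by (metis homeomorphic_eq_everything_map bij_betw_def topspace_mtopology_of mspace_graph_metric)
  then have "g (0, f 0) \<in> mspace Y" "g (1, f 1) \<in> mspace Y" "g (0, f 0) \<noteq> g (1, f 1)"
    using bij_betw_apply[OF bij, of "(0, f 0)"] bij_betw_apply[OF bij, of "(1, f 1)"]
      inj_on_eq_iff[OF bij_betw_imp_inj_on[OF bij], of "(0, f 0)" "(1, f 1)"] by simp_all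
  ultimately have "1 \<le> hausdorff_dim Y" by (rule hausdorff_dim_connected)
  then show ?thesis using True by simp
next
  case False
  interpret qs_image t "\<lambda>p q. mdist Y (g p) (g q)"
    by (rule qs_image_graph[OF t sub qs])
  have img: "mspace Y = g ` mspace (graph_metric f)"
    using qs unfolding quasisymmetric_homeo_def
    by (metis homeomorphic_eq_everything_map topspace_mtopology_of)
  show ?thesis
  proof (rule hausdorff_dim_geI)
    fix r assume r: "0 \<le> r" "r < 1 + t"
    \<comment> \<open>Exponents below 1 are raised to 1, which stays below \<open>1 + t\<close>
      because \<open>t\<close> is positive.\<close>
    define s where "s = max r 1"
    have s: "1 \<le> s" "s < 1 + t" "r \<le> s" using r t False by (auto simp: s_def)
    obtain \<epsilon> :: real where \<epsilon>: "\<epsilon> > 0" and lower: "\<And>U \<rho>. (\<forall>l. 0 < \<rho> l) \<Longrightarrow>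
      (\<forall>l. \<forall>u\<in>U l. \<forall>v\<in>U l. mdist Y (g (curve_point (fst u) (snd u))) (g (curve_point (fst v) (snd v))) \<le> \<rho> l) \<Longrightarrow>
      (\<forall>C R. C \<subseteq> free_pos t \<longrightarrow> (\<exists>l::nat. (C, R) \<in> U l)) \<Longrightarrow> ennreal \<epsilon> \<le> (\<Sum>l. ennreal (\<rho> l powr s))"
      using no_small_cover[OF s(1,2)] by blast
    show "hausdorff_measure Y r (mspace Y) \<noteq> 0"
    proof
      assume "hausdorff_measure Y r (mspace Y) = 0"
      from hausdorff_measure_0_cover[OF this r(1) s(3,1) \<epsilon>]
      obtain V \<rho> where V: "(\<forall>l::nat. 0 < \<rho> l \<and> V l \<subseteq> mspace Y \<and> (\<forall>x\<in>V l. \<forall>y\<in>V l. mdist Y x y \<le> \<rho> l)) \<and>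
          mspace Y \<subseteq> (\<Union>l. V l) \<and> (\<Sum>l. ennreal (\<rho> l powr s)) < ennreal \<epsilon>"
        by (elim exE)
      define U where "U l = {u. g (curve_point (fst u) (snd u)) \<in> V l}" for l
      have "ennreal \<epsilon> \<le> (\<Sum>l. ennreal (\<rho> l powr s))"
      proof (rule lower)
        show "\<forall>C R. C \<subseteq> free_pos t \<longrightarrow> (\<exists>l. (C, R) \<in> U l)"
        proof (intro allI impI)
          fix C R assume "C \<subseteq> free_pos t"
          then have "curve_point C R \<in> mspace (graph_metric f)"
            using sub curve_point_in by blast
          then have "g (curve_point C R) \<in> mspace Y" unfolding img by (rule imageI)
          then obtain l where "g (curve_point C R) \<in> V l" using V by blast
          then show "\<exists>l. (C, R) \<in> U l" by (auto simp: U_def)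
        qed
        show "\<forall>l. \<forall>u\<in>U l. \<forall>v\<in>U l.
            mdist Y (g (curve_point (fst u) (snd u))) (g (curve_point (fst v) (snd v))) \<le> \<rho> l"
          unfolding U_def mem_Collect_eq Ball_def using V by blast
      qed (use V in blast)
      moreover have "(\<Sum>l. ennreal (\<rho> l powr s)) < ennreal \<epsilon>" using V by blast
      ultimately show False by (meson not_le)
    qed
  qed
qed

lemma quasisymmetric_homeo_id: "quasisymmetric_homeo X X (\<lambda>x. x)"
  unfolding quasisymmetric_homeo_def
proof (intro conjI exI)
  show "homeomorphic_map (mtopology_of X) (mtopology_of X) (\<lambda>x. x)"
    by (simp flip: id_def)
  show "homeomorphism {0..} {0..} (\<lambda>x. x) (\<lambda>x. x :: real)"
    by (rule homeomorphism_ident)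
qed simp

theorem corollary1p4:
  fixes d :: real
  assumes "d \<in> {1..2}"
  shows "\<exists>f :: real \<Rightarrow> real. continuous_on {0..1} f \<and>
           minimal_for_conformal_dim (graph_metric f) \<and>
           conformal_dim (graph_metric f) = ennreal d"
proof -
  have t: "0 \<le> d - 1" "d - 1 \<le> 1" using assms by auto
  obtain f where f: "continuous_on {0..1} f" "cantor_curve (d - 1) \<subseteq> mspace (graph_metric f)"
      "hausdorff_dim (graph_metric f) \<le> ennreal (1 + (d - 1))"
    using graph_through_curve[OF t] by blast
  have "ennreal (1 + (d - 1)) \<le> conformal_dim (graph_metric f)"
    unfolding conformal_dim_def
  proof (rule INF_greatest)
    fix Y :: "(real \<times> real) metric"
    assume "Y \<in> {Y. \<exists>g. quasisymmetric_homeo (graph_metric f) Y g}"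
    then show "ennreal (1 + (d - 1)) \<le> hausdorff_dim Y"
      using hausdorff_dim_qs_graph_ge[OF t f(2,1)] by blast
  qed
  moreover have "conformal_dim (graph_metric f) \<le> hausdorff_dim (graph_metric f)"
    by (rule conformal_dim_le[OF quasisymmetric_homeo_id])
  \<comment> \<open>Both dimensions are squeezed: the lower bound \<open>d\<close> holds for
    \<open>conformal_dim\<close>, the upper bound \<open>d\<close> for \<open>hausdorff_dim\<close>,
    and the identity map orders the two.\<close>
  ultimately have "conformal_dim (graph_metric f) = ennreal d" "hausdorff_dim (graph_metric f) = ennreal d"
    using f(3) by (simp_all add: antisym)
  with f(1) show ?thesis
    unfolding minimal_for_conformal_dim_def by metis
qed

end
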